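(* Let $\underline C=(C_1,\dots,C_d)$ be a coisometric tuple on a Hilbert space $\mathcal H_C$ and let $\underline E=(E_1,\dots,E_d)$ be a coisometric lifting of $\underline C$ on a Hilbert space $\mathcal H_E\supset\mathcal H_C$, with $\mathcal H_A:=\mathcal H_E\ominus\mathcal H_C$. With the row isometry $\underline V^E=(V_1^E,\dots,V_d^E)$ on $\mathcal H_A\oplus(\Gamma\otimes\mathcal D_E)$ and the operator $W^*:\Gamma\otimes\mathcal D_C\to\mathcal H_A\oplus(\Gamma\otimes\mathcal D_E)$ defined in the context, put $$\mathcal E_*=W^*(e_\emptyset\otimes\mathcal D_C),\qquad \mathcal E=e_\emptyset\otimes\mathcal D_E .$$ Then the collection $$\Big(\underline V^E=(V_1^E,\dots,V_d^E),\ \ \mathcal H_A\oplus(\Gamma\otimes\mathcal D_E),\ \ \mathcal G_*^+=\bigoplus_{\alpha\in\tilde\Lambda}V_\alpha^E\mathcal E_*,\ \ \mathcal G=\bigoplus_{\alpha\in\tilde\Lambda}V_\alpha^E\mathcal E\Big)$$ is an outgoing Cuntz scattering system.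
   Context: Let $d\ge 1$ be finite. For a tuple $\underline T=(T_1,\dots,T_d)$ of bounded operators on a Hilbert space $\mathcal L$: $\underline T$ is a row contraction if $\sum_j T_jT_j^*\le I$; coisometric if $\sum_jT_jT_j^*=I$; a row isometry if the $T_j$ are isometries with mutually orthogonal ranges. $\tilde\Lambda$ is the free semigroup (with empty word $\emptyset$) on $1,\dots,d$; $|\alpha|$ is the length of a word $\alpha$; for $\alpha=\alpha_1\cdots\alpha_n$, $T_\alpha=T_{\alpha_1}\cdots T_{\alpha_n}$ and $T_\emptyset=I$. A (closed) subspace $\mathcal M$ of $\mathcal L$ is wandering for a row isometry $\underline T$ if $T_\alpha\mathcal M\perp T_\beta\mathcal M$ for distinct $\alpha,\beta\in\tilde\Lambda$. $\underline T$ is a row shift if it is a row isometry and $\mathcal L=\bigoplus_{\alpha\in\tilde\Lambda}T_\alpha\mathcal M$ for some wandering subspace $\mathcal M$. An outgoing Cuntz scattering system is a collection $(\underline V=(V_1,\dots,V_d),\mathcal L,\mathcal G_*^+,\mathcal G)$ such that $\underline V$ is a row isometry on the Hilbert space $\mathcal L$, and $\mathcal G_*^+,\mathcal G$ are subspaces of $\mathcal L$ with: (a) $\mathcal G_*^+$ is the smallest $\underline V$-invariant subspace containing $\mathcal E_*:=\mathcal L\ominus\overline{\mathrm{span}}_{j=1,\dots,d}V_j\mathcal L$; thus $\underline V|_{\mathcal G_*^+}$ is a row shift and $\mathcal G_*^+=\bigoplus_{\alpha\in\tilde\Lambda}V_\alpha\mathcal E_*$; (b) $\underline V|_{\mathcal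 G}$ is a row shift; thus $\mathcal G=\bigoplus_{\alpha\in\tilde\Lambda}V_\alpha\mathcal E$ where $\mathcal E:=\mathcal G\ominus\overline{\mathrm{span}}_{j=1,\dots,d}V_j\mathcal G$. (So the assertion includes that the spaces $\mathcal E_*$ and $\mathcal E$ of the claim are the ones appearing in (a) and (b).) For a row contraction $\underline T$ on $\mathcal L$, regarded as a row operator $\underline T:\bigoplus_1^d\mathcal L\to\mathcal L$, put $D_T=(I-\underline T^*\underline T)^{1/2}$ on $\bigoplus_1^d\mathcal L$, let $\mathcal D_T$ be the closure of its range, and let $(D_T)_j:\mathcal L\to\mathcal D_T$ be $(D_T)_j\ell=D_T(0,\dots,\ell,\dots,0)$ with $\ell$ in the $j$-th component. $\Gamma=\bigoplus_{m\ge0}(\mathbb C^d)^{\otimes m}$ is the full Fock space with orthonormal basis $e_\alpha=e_{\alpha_1}\otimes\cdots\otimes e_{\alpha_m}$, $\alpha=\alpha_1\cdots\alpha_m\in\tilde\Lambda$, and vacuum vector $e_\emptyset$. Popescu's presentation of the minimal isometric dilation of $\underline T$ is the tuple on $\mathcal L\oplus(\Gamma\otimes\mathcal D_T)$ given by $V_j(\ell\oplus\sum_\alpha e_\alpha\otimes d_\alpha)=T_j\ell\oplus[e_\emptyset\otimes(D_T)_j\ell+e_j\otimes\sum_\alpha e_\alpha\otimes d_\alpha]$. Let $\underline{\widehat V}^E$ be this dilation for $\underline T=\underline E$, on $\widehat{\mathcal H}_E=\mathcal H_E\oplus(\Gamma\otimes\mathcal D_E)$; put also $\widehat{\mathcal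 H}_C=\mathcal H_C\oplus(\Gamma\otimes\mathcal D_C)$. A coisometric tuple $\underline E$ on $\mathcal H_E\supset\mathcal H_C$ is a coisometric lifting of $\underline C$ if, with respect to $\mathcal H_E=\mathcal H_C\oplus\mathcal H_A$, $E_j=\begin{pmatrix}C_j&0\\ B_j&A_j\end{pmatrix}$ for $j=1,\dots,d$. The space $\mathcal H_A\oplus(\Gamma\otimes\mathcal D_E)$ is invariant for each $\widehat V_j^E$, and $V_j^E:=\widehat V_j^E|_{\mathcal H_A\oplus(\Gamma\otimes\mathcal D_E)}$. Let $\mathcal P$ be a $d$-dimensional Hilbert space with orthonormal basis $\epsilon_1,\dots,\epsilon_d$, and $\mathcal P_{[1,n]}=\mathcal P^{\otimes n}$ (for $n=0$: $\mathbb C$). For $n\ge1$ the unitary $$\tilde U_n:\mathcal H_C\otimes\mathcal P_{[1,n-1]}\oplus\bigoplus_{m\ge n-1}\big((\mathbb C^d)^{\otimes m}\otimes\mathcal D_C\big)\to\mathcal H_C\otimes\mathcal P_{[1,n]}\oplus\bigoplus_{m\ge n}\big((\mathbb C^d)^{\otimes m}\otimes\mathcal D_C\big)$$ is defined by $$\tilde U_n\Big(\sum_{j_1,\dots,j_{n-1}}\tilde h_{j_1\cdots j_{n-1}}\otimes\epsilon_{j_1}\otimes\cdots\otimes\epsilon_{j_{n-1}}\oplus\sum_{j_1,\dots,j_{n-1}}e_{j_1}\otimes\cdots\otimes e_{j_{n-1}}\otimes y_{j_1\cdots j_{n-1}}\oplus\sum_{|\alpha|\ge n}e_\alpha\otimes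 y_\alpha\Big)$$ $$=\sum_{j_1,\dots,j_n}\big(C_{j_n}^*\tilde h_{j_1\cdots j_{n-1}}+(D_C)_{j_n}^*y_{j_1\cdots j_{n-1}}\big)\otimes\epsilon_{j_1}\otimes\cdots\otimes\epsilon_{j_n}\oplus\sum_{|\alpha|\ge n}e_\alpha\otimes y_\alpha$$ with $\tilde h_{\cdots}\in\mathcal H_C$, $y_{\cdots}\in\mathcal D_C$ (for $n=1$: $\tilde U_1(\tilde h\oplus\sum_\alpha e_\alpha\otimes y_\alpha)=\sum_j(C_j^*\tilde h+(D_C)_j^*y_\emptyset)\otimes\epsilon_j\oplus\sum_{|\alpha|\ge1}e_\alpha\otimes y_\alpha$ on $\widehat{\mathcal H}_C$). The unitaries $U_n$ are defined by the same formulas with $\mathcal H_C,\mathcal D_C,C_j,(D_C)_j$ replaced by $\mathcal H_E,\mathcal D_E,E_j,(D_E)_j$. Let $Q_n$ be the orthogonal projection of $\widehat{\mathcal H}_C$ onto $\mathcal H_C\oplus\bigoplus_{m\le n-1}((\mathbb C^d)^{\otimes m}\otimes\mathcal D_C)$. Regarding $\mathcal H_C\otimes\mathcal P_{[1,n]}$ as a subspace of both the codomain of $\tilde U_n$ and the codomain of $U_n$, the strong operator limit $$\widehat W^*=\text{sot-}\lim_{n\to\infty}U_1^*\cdots U_n^*\tilde U_n\cdots\tilde U_1Q_n:\widehat{\mathcal H}_C\to\widehat{\mathcal H}_E$$ exists and is an isometry; it is the identity on $\mathcal H_C$ and maps $\Gamma\otimes\mathcal D_C$ into $\mathcal H_A\oplus(\Gamma\otimes\mathcal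 D_E)$. Define $W^*:=\widehat W^*|_{\Gamma\otimes\mathcal D_C}:\Gamma\otimes\mathcal D_C\to\mathcal H_A\oplus(\Gamma\otimes\mathcal D_E)$. *)

theory Defs
  imports "HOL-Analysis.Analysis"
begin

section \<open>Complex Hilbert spaces\<close>

text \<open>A complex Hilbert space is a complete real inner product space with a compatible complex
  structure. The sesquilinear form \<open>cinner\<close> is antilinear in its first argument; its real part is
  the real inner product, so norm and topology are the library's.\<close>

class complex_hilbert = real_inner + complete_space +
  fixes scaleC :: "complex \<Rightarrow> 'a \<Rightarrow> 'a" (infixr "*\<^sub>C" 75)
    and cinner :: "'a \<Rightarrow> 'a \<Rightarrow> complex"
  assumes scaleC_add_right: "c *\<^sub>C (x + y) = c *\<^sub>C x + c *\<^sub>C y"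
    and scaleC_add_left: "(b + c) *\<^sub>C x = b *\<^sub>C x + c *\<^sub>C x"
    and scaleC_scaleC: "b *\<^sub>C c *\<^sub>C x = (b * c) *\<^sub>C x"
    and scaleC_of_real: "complex_of_real r *\<^sub>C x = r *\<^sub>R x"
    and cinner_commute: "cinner x y = cnj (cinner y x)"
    and cinner_add_right: "cinner x (y + z) = cinner x y + cinner x z"
    and cinner_scaleC_right: "cinner x (c *\<^sub>C y) = c * cinner x y"
    and Re_cinner: "Re (cinner x y) = inner x y"

lemma cinner_self: "cinner x x = complex_of_real ((norm x)\<^sup>2)" for x :: "'a::complex_hilbert"
proof (rule complex_eqI)
  show "Re (cinner x x) = Re (complex_of_real ((norm x)\<^sup>2))"
    by (simp add: Re_cinner power2_norm_eq_inner)
  have "Im (cinner x x) = - Im (cinner x x)"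
    using cinner_commute[of x x] by (metis complex_cnj cnj.simps(2))
  then show "Im (cinner x x) = Im (complex_of_real ((norm x)\<^sup>2))" by simp
qed

lemma norm_scaleC: "norm (c *\<^sub>C x) = cmod c * norm x" for x :: "'a::complex_hilbert"
proof -
  have "cinner (c *\<^sub>C x) (c *\<^sub>C x) = c * cnj c * cinner x x"
    by (metis cinner_scaleC_right cinner_commute complex_cnj_mult mult.assoc)
  also have "\<dots> = complex_of_real ((cmod c * norm x)\<^sup>2)"
    by (simp add: cinner_self complex_norm_square power_mult_distrib flip: complex_norm_square)
  finally have "(norm (c *\<^sub>C x))\<^sup>2 = (cmod c * norm x)\<^sup>2"
    unfolding cinner_self of_real_eq_iff .
  then show ?thesis by (simp add: power2_eq_iff_nonneg)
qed

lemma cmod_cinner_le: "cmod (cinner x y) \<le> 2 * (norm x * norm y)" for x y :: "'a::complex_hilbert"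
proof -
  have "Im (cinner x y) = Re (cinner x ((- \<i>) *\<^sub>C y))"
    by (simp add: cinner_scaleC_right)
  then have "\<bar>Im (cinner x y)\<bar> \<le> norm x * norm y"
    using Cauchy_Schwarz_ineq2[of x "(- \<i>) *\<^sub>C y"] by (simp add: Re_cinner norm_scaleC)
  moreover have "\<bar>Re (cinner x y)\<bar> \<le> norm x * norm y"
    using Cauchy_Schwarz_ineq2[of x y] by (simp add: Re_cinner)
  ultimately show ?thesis
    using cmod_le[of "cinner x y"] by linarith
qed

instantiation complex :: complex_hilbert
begin
definition "scaleC c z = c * (z::complex)"
definition "cinner w z = cnj w * (z::complex)"
instance
  by standard
    (auto simp: scaleC_complex_def cinner_complex_def algebra_simps scaleR_conv_of_real inner_complex_def)
end

instantiation prod :: (complex_hilbert, complex_hilbert) complex_hilbert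
begin
definition "scaleC c x = (c *\<^sub>C fst x, c *\<^sub>C snd x)"
definition "cinner x y = cinner (fst x) (fst y) + cinner (snd x) (snd y)"
instance
proof
  fix x y :: "'a \<times> 'b"
  show "cinner x y = cnj (cinner y x)"
    unfolding cinner_prod_def complex_cnj_add by (metis cinner_commute)
qed (auto simp: scaleC_prod_def cinner_prod_def scaleC_add_right scaleC_add_left scaleC_scaleC
    scaleC_of_real cinner_add_right cinner_scaleC_right Re_cinner inner_prod_def algebra_simps
    prod_eq_iff)
end

instantiation vec :: (complex_hilbert, finite) complex_hilbert
begin
definition "scaleC c x = (\<chi> i. c *\<^sub>C (x $ i))"
definition "cinner x y = (\<Sum>i\<in>UNIV. cinner (x $ i) (y $ i))"
instance
proof
  fix x y :: "'a ^ 'b"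
  show "cinner x y = cnj (cinner y x)"
    unfolding cinner_vec_def cnj_sum by (metis cinner_commute)
qed (auto simp: scaleC_vec_def cinner_vec_def scaleC_add_right scaleC_add_left scaleC_scaleC
    scaleC_of_real cinner_add_right cinner_scaleC_right Re_cinner inner_vec_def sum.distrib
    sum_distrib_left vec_eq_iff)
end


section \<open>Square-summable families\<close>

text \<open>\<open>('i, 'a) ell2\<close> is the Hilbert space tensor product of \<open>\<ell>\<^sup>2('i)\<close> and \<open>'a\<close>, written in the
  orthonormal basis of the first factor: the family \<open>f\<close> stands for \<open>\<Sum>i. e\<^sub>i \<otimes> f i\<close>.\<close>

typedef (overloaded) ('i, 'a::complex_hilbert) ell2 =
  "{f :: 'i \<Rightarrow> 'a. (\<lambda>i. (norm (f i))\<^sup>2) summable_on UNIV}"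
  morphisms ell2_nth Abs_ell2
  by (rule exI[of _ "\<lambda>_. 0"]) simp

setup_lifting type_definition_ell2

lemma ell2_summable: "(\<lambda>i. (norm (ell2_nth f i))\<^sup>2) summable_on UNIV"
  using ell2_nth by auto

lemma ell2_eqI: "(\<And>i. ell2_nth f i = ell2_nth g i) \<Longrightarrow> f = g"
  by (metis ell2_nth_inject ext)

lemma summable_square_add:
  fixes f g :: "'i \<Rightarrow> 'a::real_inner"
  assumes "(\<lambda>i. (norm (f i))\<^sup>2) summable_on UNIV" "(\<lambda>i. (norm (g i))\<^sup>2) summable_on UNIV"
  shows "(\<lambda>i. (norm (f i + g i))\<^sup>2) summable_on UNIV"
proof (rule summable_on_comparison_test)
  show "(\<lambda>i. 2 * (norm (f i))\<^sup>2 + 2 * (norm (g i))\<^sup>2) summable_on UNIV"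
    by (intro summable_on_add summable_on_cmult_right assms)
  fix i
  have "(norm (f i + g i))\<^sup>2 \<le> (norm (f i) + norm (g i))\<^sup>2"
    by (simp add: norm_triangle_ineq power_mono)
  also have "\<dots> \<le> 2 * (norm (f i))\<^sup>2 + 2 * (norm (g i))\<^sup>2"
    using zero_le_power2[of "norm (f i) - norm (g i)"] by (simp add: power2_eq_square algebra_simps)
  finally show "(norm (f i + g i))\<^sup>2 \<le> 2 * (norm (f i))\<^sup>2 + 2 * (norm (g i))\<^sup>2" .
qed auto

lemma summable_square_subset:
  fixes f :: "'i \<Rightarrow> 'a::real_inner"
  assumes "(\<lambda>i. (norm (f i))\<^sup>2) summable_on UNIV"
  shows "(\<lambda>i. (norm (if i \<in> A then f i else 0))\<^sup>2) summable_on UNIV"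
  by (rule summable_on_comparison_test[OF assms]) auto

lemma summable_cinner:
  fixes f g :: "'i \<Rightarrow> 'a::complex_hilbert"
  assumes "(\<lambda>i. (norm (f i))\<^sup>2) summable_on UNIV" "(\<lambda>i. (norm (g i))\<^sup>2) summable_on UNIV"
  shows "(\<lambda>i. cinner (f i) (g i)) summable_on UNIV"
proof (rule abs_summable_summable, rule summable_on_comparison_test)
  show "(\<lambda>i. (norm (f i))\<^sup>2 + (norm (g i))\<^sup>2) summable_on UNIV"
    by (intro summable_on_add assms)
  fix i
  show "cmod (cinner (f i) (g i)) \<le> (norm (f i))\<^sup>2 + (norm (g i))\<^sup>2"
    using cmod_cinner_le[of "f i" "g i"] zero_le_power2[of "norm (f i) - norm (g i)"]
    by (simp add: power2_eq_square algebra_simps)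
qed auto

lemma summable_inner:
  fixes f g :: "'i \<Rightarrow> 'a::complex_hilbert"
  assumes "(\<lambda>i. (norm (f i))\<^sup>2) summable_on UNIV" "(\<lambda>i. (norm (g i))\<^sup>2) summable_on UNIV"
  shows "(\<lambda>i. inner (f i) (g i)) summable_on UNIV"
  using summable_on_Re[OF summable_cinner[OF assms]] by (simp add: Re_cinner)

instantiation ell2 :: (type, complex_hilbert) real_inner
begin

lift_definition zero_ell2 :: "('a, 'b) ell2" is "\<lambda>_. 0" by simp
lift_definition plus_ell2 :: "('a, 'b) ell2 \<Rightarrow> ('a, 'b) ell2 \<Rightarrow> ('a, 'b) ell2"
  is "\<lambda>f g i. f i + g i" by (rule summable_square_add)
lift_definition uminus_ell2 :: "('a, 'b) ell2 \<Rightarrow> ('a, 'b) ell2" is "\<lambda>f i. - f i" by simp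
lift_definition minus_ell2 :: "('a, 'b) ell2 \<Rightarrow> ('a, 'b) ell2 \<Rightarrow> ('a, 'b) ell2"
  is "\<lambda>f g i. f i - g i"
proof -
  fix f g :: "'a \<Rightarrow> 'b"
  assume "(\<lambda>i. (norm (f i))\<^sup>2) summable_on UNIV" "(\<lambda>i. (norm (g i))\<^sup>2) summable_on UNIV"
  then show "(\<lambda>i. (norm (f i - g i))\<^sup>2) summable_on UNIV"
    using summable_square_add[of f "\<lambda>i. - g i"] by simp
qed
lift_definition scaleR_ell2 :: "real \<Rightarrow> ('a, 'b) ell2 \<Rightarrow> ('a, 'b) ell2" is "\<lambda>r f i. r *\<^sub>R f i"
  by (simp add: power_mult_distrib summable_on_cmult_right)
lift_definition inner_ell2 :: "('a, 'b) ell2 \<Rightarrow> ('a, 'b) ell2 \<Rightarrow> real"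
  is "\<lambda>f g. \<Sum>\<^sub>\<infinity>i. inner (f i) (g i)" .
definition norm_ell2 :: "('a, 'b) ell2 \<Rightarrow> real" where "norm_ell2 f = sqrt (inner f f)"
definition sgn_ell2 :: "('a, 'b) ell2 \<Rightarrow> ('a, 'b) ell2" where "sgn_ell2 f = inverse (norm f) *\<^sub>R f"
definition dist_ell2 :: "('a, 'b) ell2 \<Rightarrow> ('a, 'b) ell2 \<Rightarrow> real" where "dist_ell2 f g = norm (f - g)"
definition uniformity_ell2 :: "(('a, 'b) ell2 \<times> ('a, 'b) ell2) filter"
  where "uniformity_ell2 = (INF e\<in>{0<..}. principal {(f, g). dist f g < e})"
definition open_ell2 :: "('a, 'b) ell2 set \<Rightarrow> bool"
  where "open_ell2 U \<longleftrightarrow> (\<forall>x\<in>U. eventually (\<lambda>(x', y). x' = x \<longrightarrow> y \<in> U) uniformity)"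

instance
proof
  fix f g h :: "('a, 'b) ell2" and r s :: real
  show "f + g + h = f + (g + h)" "f + g = g + f" "0 + f = f" "- f + f = 0" "f - g = f + - g"
    by (transfer, simp add: algebra_simps)+
  show "r *\<^sub>R (f + g) = r *\<^sub>R f + r *\<^sub>R g" "(r + s) *\<^sub>R f = r *\<^sub>R f + s *\<^sub>R f"
    "r *\<^sub>R s *\<^sub>R f = (r * s) *\<^sub>R f" "1 *\<^sub>R f = f"
    by (transfer, simp add: algebra_simps)+
  show "sgn f = inverse (norm f) *\<^sub>R f" by (rule sgn_ell2_def)
  show "dist f g = norm (f - g)" by (rule dist_ell2_def)
  show "norm f = sqrt (inner f f)" by (rule norm_ell2_def)
  show "uniformity = (INF e\<in>{0<..}. principal {(x::('a, 'b) ell2, y). dist x y < e})"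
    by (rule uniformity_ell2_def)
  show "open U = (\<forall>x\<in>U. \<forall>\<^sub>F (x', y) in uniformity. x' = x \<longrightarrow> y \<in> U)" for U :: "('a, 'b) ell2 set"
    by (rule open_ell2_def)
  show "inner f g = inner g f" by transfer (simp add: inner_commute)
  show "inner (f + g) h = inner f h + inner g h"
    by transfer (simp add: inner_add_left infsum_add summable_inner)
  show "inner (r *\<^sub>R f) g = r * inner f g"
    by transfer (simp add: infsum_cmult_right')
  show "0 \<le> inner f f" by transfer (simp add: infsum_nonneg)
  show "inner f f = 0 \<longleftrightarrow> f = 0"
  proof
    assume "inner f f = 0"
    then have "ell2_nth f i = 0" for i
      using nonneg_infsum_le_0D[of "\<lambda>i. inner (ell2_nth f i) (ell2_nth f i)" UNIV i]
        summable_inner[OF ell2_summable[of f] ell2_summable[of f]]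
      by (simp add: inner_ell2.rep_eq)
    then show "f = 0" by (intro ell2_eqI) (simp add: zero_ell2.rep_eq)
  next
    show "f = 0 \<Longrightarrow> inner f f = 0" by transfer simp
  qed
qed

end

lemma norm_ell2_square: "(norm f)\<^sup>2 = (\<Sum>\<^sub>\<infinity>i. (norm (ell2_nth f i))\<^sup>2)"
  by (simp add: power2_norm_eq_inner inner_ell2.rep_eq)

lemma ell2_sum_le_norm:
  assumes "finite F" shows "(\<Sum>i\<in>F. (norm (ell2_nth f i))\<^sup>2) \<le> (norm f)\<^sup>2"
  unfolding norm_ell2_square by (rule finite_sum_le_infsum) (auto simp: assms ell2_summable)

lemma norm_ell2_nth_le: "norm (ell2_nth f i) \<le> norm f"
  using ell2_sum_le_norm[of "{i}" f] by (simp add: power2_le_iff_abs_le)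

lemma norm_ell2_le:
  assumes "\<And>F. finite F \<Longrightarrow> (\<Sum>i\<in>F. (norm (ell2_nth f i))\<^sup>2) \<le> B\<^sup>2" "0 \<le> B"
  shows "norm f \<le> B"
proof -
  have "(norm f)\<^sup>2 \<le> B\<^sup>2"
    unfolding norm_ell2_square by (rule infsum_le_finite_sums) (auto simp: ell2_summable assms)
  then show ?thesis using assms(2) by (rule power2_le_imp_le)
qed

instance ell2 :: (type, complex_hilbert) complete_space
proof
  fix X :: "nat \<Rightarrow> ('a, 'b) ell2"
  assume X: "Cauchy X"
  have "Cauchy (\<lambda>n. ell2_nth (X n) i)" for i
  proof (rule CauchyI)
    fix e :: real assume "0 < e"
    then obtain N where N: "\<And>m n. m \<ge> N \<Longrightarrow> n \<ge> N \<Longrightarrow> norm (X m - X n) < e"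
      using CauchyD[OF X] by blast
    have "norm (ell2_nth (X m) i - ell2_nth (X n) i) < e" if "m \<ge> N" "n \<ge> N" for m n
      using N[OF that] norm_ell2_nth_le[of "X m - X n" i] by (simp add: minus_ell2.rep_eq)
    then show "\<exists>N. \<forall>m\<ge>N. \<forall>n\<ge>N. norm (ell2_nth (X m) i - ell2_nth (X n) i) < e" by blast
  qed
  then have "\<exists>l. (\<lambda>n. ell2_nth (X n) i) \<longlonglongrightarrow> l" for i
    by (simp add: Cauchy_convergent convergentD)
  then obtain l where l: "\<And>i. (\<lambda>n. ell2_nth (X n) i) \<longlonglongrightarrow> l i" by metis
  have tail: "(\<Sum>i\<in>F. (norm (ell2_nth (X m) i - l i))\<^sup>2) \<le> e\<^sup>2"
    if N: "\<And>m n. m \<ge> N \<Longrightarrow> n \<ge> N \<Longrightarrow> norm (X m - X n) < e" and "m \<ge> N" "finite F" "0 < e"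
    for N e m F
  proof (rule LIMSEQ_le_const2)
    show "(\<lambda>n. \<Sum>i\<in>F. (norm (ell2_nth (X m) i - ell2_nth (X n) i))\<^sup>2)
      \<longlonglongrightarrow> (\<Sum>i\<in>F. (norm (ell2_nth (X m) i - l i))\<^sup>2)"
      by (intro tendsto_intros l)
    have "(\<Sum>i\<in>F. (norm (ell2_nth (X m) i - ell2_nth (X n) i))\<^sup>2) \<le> e\<^sup>2" if "n \<ge> N" for n
    proof -
      have "(\<Sum>i\<in>F. (norm (ell2_nth (X m - X n) i))\<^sup>2) \<le> (norm (X m - X n))\<^sup>2"
        by (rule ell2_sum_le_norm) fact
      also have "\<dots> \<le> e\<^sup>2"
        using N[OF \<open>m \<ge> N\<close> \<open>n \<ge> N\<close>] by (intro power_mono) auto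
      finally show ?thesis by (simp add: minus_ell2.rep_eq)
    qed
    then show "\<exists>N. \<forall>n\<ge>N. (\<Sum>i\<in>F. (norm (ell2_nth (X m) i - ell2_nth (X n) i))\<^sup>2) \<le> e\<^sup>2" by blast
  qed
  obtain N1 where N1: "\<And>m n. m \<ge> N1 \<Longrightarrow> n \<ge> N1 \<Longrightarrow> norm (X m - X n) < 1"
    using CauchyD[OF X, of 1] by auto
  have "(\<lambda>i. (norm (ell2_nth (X N1) i - l i))\<^sup>2) summable_on UNIV"
  proof (rule nonneg_bounded_partial_sums_imp_summable_on)
    show "\<forall>\<^sub>F F in finite_subsets_at_top UNIV. (\<Sum>i\<in>F. (norm (ell2_nth (X N1) i - l i))\<^sup>2) \<le> 1\<^sup>2"
      using tail[OF N1] by (intro eventually_finite_subsets_at_top_weakI) auto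
  qed auto
  then have "(\<lambda>i. (norm (l i - ell2_nth (X N1) i))\<^sup>2) summable_on UNIV"
    by (simp add: norm_minus_commute)
  from summable_square_add[OF this ell2_summable[of "X N1"]]
  have "(\<lambda>i. (norm (l i))\<^sup>2) summable_on UNIV" by simp
  then have nth: "ell2_nth (Abs_ell2 l) = l" by (simp add: Abs_ell2_inverse)
  have "X \<longlonglongrightarrow> Abs_ell2 l"
  proof (rule LIMSEQ_I)
    fix r :: real assume "0 < r"
    then have "0 < r / 2" by simp
    from CauchyD[OF X this] obtain N
      where N: "\<And>m n. m \<ge> N \<Longrightarrow> n \<ge> N \<Longrightarrow> norm (X m - X n) < r / 2" by blast
    have "norm (X m - Abs_ell2 l) < r" if "m \<ge> N" for m
    proof -
      have "norm (X m - Abs_ell2 l) \<le> r / 2"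
        using tail[OF N that] \<open>0 < r\<close> by (intro norm_ell2_le) (auto simp: minus_ell2.rep_eq nth)
      then show ?thesis using \<open>0 < r\<close> by linarith
    qed
    then show "\<exists>no. \<forall>n\<ge>no. norm (X n - Abs_ell2 l) < r" by blast
  qed
  then show "convergent X" by (rule convergentI)
qed

instantiation ell2 :: (type, complex_hilbert) complex_hilbert
begin

lift_definition scaleC_ell2 :: "complex \<Rightarrow> ('a, 'b) ell2 \<Rightarrow> ('a, 'b) ell2" is "\<lambda>c f i. c *\<^sub>C f i"
  by (simp add: norm_scaleC power_mult_distrib summable_on_cmult_right)
lift_definition cinner_ell2 :: "('a, 'b) ell2 \<Rightarrow> ('a, 'b) ell2 \<Rightarrow> complex"
  is "\<lambda>f g. \<Sum>\<^sub>\<infinity>i. cinner (f i) (g i)" .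

instance
proof
  fix f g h :: "('a, 'b) ell2" and b c :: complex and r :: real
  show "c *\<^sub>C (f + g) = c *\<^sub>C f + c *\<^sub>C g" by transfer (simp add: scaleC_add_right)
  show "(b + c) *\<^sub>C f = b *\<^sub>C f + c *\<^sub>C f" by transfer (simp add: scaleC_add_left)
  show "b *\<^sub>C c *\<^sub>C f = (b * c) *\<^sub>C f" by transfer (simp add: scaleC_scaleC)
  show "complex_of_real r *\<^sub>C f = r *\<^sub>R f" by transfer (simp add: scaleC_of_real)
  show "cinner f g = cnj (cinner g f)"
  proof transfer
    fix f g :: "'a \<Rightarrow> 'b"
    have "(\<Sum>\<^sub>\<infinity>i. cinner (f i) (g i)) = (\<Sum>\<^sub>\<infinity>i. cnj (cinner (g i) (f i)))"
      by (metis cinner_commute)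
    then show "(\<Sum>\<^sub>\<infinity>i. cinner (f i) (g i)) = cnj (\<Sum>\<^sub>\<infinity>i. cinner (g i) (f i))"
      by (simp add: infsum_cnj)
  qed
  show "cinner f (g + h) = cinner f g + cinner f h"
    by transfer (simp add: cinner_add_right infsum_add summable_cinner)
  show "cinner f (c *\<^sub>C g) = c * cinner f g"
    by transfer (simp add: cinner_scaleC_right infsum_cmult_right')
  show "Re (cinner f g) = inner f g"
    by transfer (simp add: infsum_Re[symmetric] summable_cinner Re_cinner)
qed

end

text \<open>\<open>ell2_single i x\<close> is the elementary tensor \<open>e\<^sub>i \<otimes> x\<close>.\<close>

lift_definition ell2_single :: "'i \<Rightarrow> 'a \<Rightarrow> ('i, 'a::complex_hilbert) ell2"
  is "\<lambda>i x k. if k = i then x else 0"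
proof -
  fix i :: 'i and x :: 'a
  have "(\<lambda>k. (norm (if k = i then x else 0))\<^sup>2) summable_on {i}" by simp
  then show "(\<lambda>k. (norm (if k = i then x else 0))\<^sup>2) summable_on UNIV"
    by (rule summable_on_cong_neutral[THEN iffD1, rotated -1]) auto
qed

lift_definition ell2_restrict :: "'i set \<Rightarrow> ('i, 'a::complex_hilbert) ell2 \<Rightarrow> ('i, 'a) ell2"
  is "\<lambda>A f k. if k \<in> A then f k else 0"
  by (rule summable_square_subset)

text \<open>\<open>ell2_create j f\<close> is \<open>e\<^sub>j \<otimes> f\<close>, that is \<open>\<Sum>\<alpha>. e\<^sub>j\<^sub>\<alpha> \<otimes> f \<alpha>\<close>, for a family indexed by words.\<close>

lift_definition ell2_create :: "'d \<Rightarrow> ('d list, 'a::complex_hilbert) ell2 \<Rightarrow> ('d list, 'a) ell2"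
  is "\<lambda>j f w. case w of [] \<Rightarrow> 0 | i # v \<Rightarrow> if i = j then f v else 0"
proof -
  fix j :: 'd and f :: "'d list \<Rightarrow> 'a"
  assume f: "(\<lambda>w. (norm (f w))\<^sup>2) summable_on UNIV"
  let ?g = "\<lambda>w. case w of [] \<Rightarrow> 0 | i # v \<Rightarrow> if i = j then f v else 0"
  have "(\<lambda>w. (norm (?g w))\<^sup>2) summable_on range ((#) j)"
    using f by (subst summable_on_reindex) (auto simp: o_def)
  then show "(\<lambda>w. (norm (?g w))\<^sup>2) summable_on UNIV"
    by (rule summable_on_cong_neutral[THEN iffD1, rotated -1]) (auto split: list.splits)
qed


section \<open>Closed subspaces and operators on them\<close>

text \<open>A Hilbert space is given by a closed subspace of an ambient one. An operator on it is a
  function on the ambient type of which only the values on the subspace matter.\<close>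

definition csubspace :: "'a::complex_hilbert set \<Rightarrow> bool"
  where "csubspace S \<longleftrightarrow> 0 \<in> S \<and> (\<forall>x\<in>S. \<forall>y\<in>S. x + y \<in> S) \<and> (\<forall>c. \<forall>x\<in>S. c *\<^sub>C x \<in> S)"

definition closed_csubspace :: "'a::complex_hilbert set \<Rightarrow> bool"
  where "closed_csubspace S \<longleftrightarrow> csubspace S \<and> closed S"

definition ccspan :: "'a::complex_hilbert set \<Rightarrow> 'a set"
  where "ccspan A = closure (csubspace hull A)"

definition orth_minus :: "'a::complex_hilbert set \<Rightarrow> 'a set \<Rightarrow> 'a set"  (infixl "\<ominus>" 65)
  where "L \<ominus> M = {x \<in> L. \<forall>y\<in>M. cinner y x = 0}"

definition orth_proj :: "'a::complex_hilbert set \<Rightarrow> 'a \<Rightarrow> 'a"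
  where "orth_proj M x = (THE y. y \<in> M \<and> (\<forall>z\<in>M. cinner z (x - y) = 0))"

definition bounded_clinear_on ::
    "'a::complex_hilbert set \<Rightarrow> 'b::complex_hilbert set \<Rightarrow> ('a \<Rightarrow> 'b) \<Rightarrow> bool"
  where "bounded_clinear_on A B T \<longleftrightarrow>
    T ` A \<subseteq> B \<and>
    (\<forall>x\<in>A. \<forall>y\<in>A. T (x + y) = T x + T y) \<and>
    (\<forall>c. \<forall>x\<in>A. T (c *\<^sub>C x) = c *\<^sub>C T x) \<and>
    (\<exists>K. \<forall>x\<in>A. norm (T x) \<le> K * norm x)"

definition adjoint_on ::
    "'a::complex_hilbert set \<Rightarrow> ('a \<Rightarrow> 'b::complex_hilbert) \<Rightarrow> 'b \<Rightarrow> 'a"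
  where "adjoint_on A T y = (THE x. x \<in> A \<and> (\<forall>a\<in>A. cinner (T a) y = cinner a x))"

text \<open>The positive square root of an operator \<open>A\<close> on \<open>K\<close>; it is set to zero off \<open>K\<close> so that the
  description is unique as a function on the ambient type.\<close>

definition positive_sqrt_on :: "'a::complex_hilbert set \<Rightarrow> ('a \<Rightarrow> 'a) \<Rightarrow> 'a \<Rightarrow> 'a"
  where "positive_sqrt_on K A = (THE S. bounded_clinear_on K K S \<and>
    (\<forall>x\<in>K. cinner x (S x) \<in> \<real>\<^sub>\<ge>\<^sub>0) \<and> (\<forall>x\<in>K. S (S x) = A x) \<and> (\<forall>x. x \<notin> K \<longrightarrow> S x = 0))"


section \<open>Operator tuples\<close>

definition coisometric :: "'a::complex_hilbert set \<Rightarrow> ('d::finite \<Rightarrow> 'a \<Rightarrow> 'a) \<Rightarrow> bool"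
  where "coisometric H T \<longleftrightarrow>
    (\<forall>j. bounded_clinear_on H H (T j)) \<and> (\<forall>x\<in>H. (\<Sum>j\<in>UNIV. T j (adjoint_on H (T j) x)) = x)"

definition row_isometry :: "'a::complex_hilbert set \<Rightarrow> ('d \<Rightarrow> 'a \<Rightarrow> 'a) \<Rightarrow> bool"
  where "row_isometry L V \<longleftrightarrow>
    (\<forall>j. bounded_clinear_on L L (V j) \<and> (\<forall>x\<in>L. norm (V j x) = norm x)) \<and>
    (\<forall>i j. i \<noteq> j \<longrightarrow> (\<forall>x\<in>L. \<forall>y\<in>L. cinner (V i x) (V j y) = 0))"

abbreviation word_op :: "('d \<Rightarrow> 'a \<Rightarrow> 'a) \<Rightarrow> 'd list \<Rightarrow> 'a \<Rightarrow> 'a"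
  where "word_op T \<alpha> \<equiv> foldr T \<alpha>"

definition wandering ::
    "'a::complex_hilbert set \<Rightarrow> ('d \<Rightarrow> 'a \<Rightarrow> 'a) \<Rightarrow> 'a set \<Rightarrow> bool"
  where "wandering L V M \<longleftrightarrow> closed_csubspace M \<and> M \<subseteq> L \<and>
    (\<forall>\<alpha> \<beta>. \<alpha> \<noteq> \<beta> \<longrightarrow> (\<forall>x\<in>M. \<forall>y\<in>M. cinner (word_op V \<alpha> x) (word_op V \<beta> y) = 0))"

text \<open>For a wandering subspace \<open>M\<close> this is the orthogonal direct sum of the \<open>V\<^sub>\<alpha> M\<close>.\<close>

definition word_sum :: "('d \<Rightarrow> 'a \<Rightarrow> 'a) \<Rightarrow> 'a::complex_hilbert set \<Rightarrow> 'a set"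
  where "word_sum V M = ccspan (\<Union>\<alpha>. word_op V \<alpha> ` M)"

definition row_shift :: "'a::complex_hilbert set \<Rightarrow> ('d \<Rightarrow> 'a \<Rightarrow> 'a) \<Rightarrow> bool"
  where "row_shift L V \<longleftrightarrow> row_isometry L V \<and> (\<exists>M. wandering L V M \<and> L = word_sum V M)"

definition wandering_part :: "'a::complex_hilbert set \<Rightarrow> ('d \<Rightarrow> 'a \<Rightarrow> 'a) \<Rightarrow> 'a set"
  where "wandering_part L V = L \<ominus> ccspan (\<Union>j. V j ` L)"

definition invariant :: "('d \<Rightarrow> 'a \<Rightarrow> 'a) \<Rightarrow> 'a::complex_hilbert set \<Rightarrow> bool"
  where "invariant V M \<longleftrightarrow> closed_csubspace M \<and> (\<forall>j. V j ` M \<subseteq> M)"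

definition outgoing_Cuntz_scattering_system ::
    "('d \<Rightarrow> 'a \<Rightarrow> 'a) \<Rightarrow> 'a::complex_hilbert set \<Rightarrow> 'a set \<Rightarrow> 'a set \<Rightarrow> bool"
  where "outgoing_Cuntz_scattering_system V L Gs G \<longleftrightarrow>
    closed_csubspace L \<and> row_isometry L V \<and>
    closed_csubspace Gs \<and> Gs \<subseteq> L \<and> closed_csubspace G \<and> G \<subseteq> L \<and>
    (invariant V Gs \<and> wandering_part L V \<subseteq> Gs \<and>
      (\<forall>M. invariant V M \<and> M \<subseteq> L \<and> wandering_part L V \<subseteq> M \<longrightarrow> Gs \<subseteq> M)) \<and>
    row_shift Gs V \<and>
    row_shift G V"


section \<open>Defect operators and the isometric dilation\<close>

definition direct_sum :: "'a::complex_hilbert set \<Rightarrow> ('a ^ 'd::finite) set"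
  where "direct_sum H = {v. \<forall>j. v $ j \<in> H}"

definition row_op :: "('d::finite \<Rightarrow> 'a \<Rightarrow> 'a) \<Rightarrow> 'a ^ 'd \<Rightarrow> 'a::complex_hilbert"
  where "row_op T v = (\<Sum>j\<in>UNIV. T j (v $ j))"

definition defect_op ::
    "'a::complex_hilbert set \<Rightarrow> ('d::finite \<Rightarrow> 'a \<Rightarrow> 'a) \<Rightarrow> 'a ^ 'd \<Rightarrow> 'a ^ 'd"
  where "defect_op H T = positive_sqrt_on (direct_sum H)
    (\<lambda>v. v - adjoint_on (direct_sum H) (row_op T) (row_op T v))"

definition defect_space ::
    "'a::complex_hilbert set \<Rightarrow> ('d::finite \<Rightarrow> 'a \<Rightarrow> 'a) \<Rightarrow> ('a ^ 'd) set"
  where "defect_space H T = closure (defect_op H T ` direct_sum H)"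

definition defect_comp ::
    "'a::complex_hilbert set \<Rightarrow> ('d::finite \<Rightarrow> 'a \<Rightarrow> 'a) \<Rightarrow> 'd \<Rightarrow> 'a \<Rightarrow> 'a ^ 'd"
  where "defect_comp H T j l = defect_op H T (axis j l)"

text \<open>\<open>fock_tensor D\<close> is the tensor product of the full Fock space over \<open>\<complex>\<^sup>d\<close> with \<open>D\<close>, the letter
  indices being the elements of the finite type \<open>'d\<close>.\<close>

definition fock_tensor :: "'b::complex_hilbert set \<Rightarrow> ('d list, 'b) ell2 set"
  where "fock_tensor D = {f. \<forall>\<alpha>. ell2_nth f \<alpha> \<in> D}"

type_synonym ('a, 'd) dil = "'a \<times> ('d list, 'a ^ 'd) ell2"

definition dilation_space ::
    "'a::complex_hilbert set \<Rightarrow> ('d::finite \<Rightarrow> 'a \<Rightarrow> 'a) \<Rightarrow> ('a, 'd) dil set"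
  where "dilation_space H T = H \<times> fock_tensor (defect_space H T)"

definition dilation ::
    "'a::complex_hilbert set \<Rightarrow> ('d::finite \<Rightarrow> 'a \<Rightarrow> 'a) \<Rightarrow> 'd \<Rightarrow> ('a, 'd) dil \<Rightarrow> ('a, 'd) dil"
  where "dilation H T j = (\<lambda>(l, f). (T j l, ell2_single [] (defect_comp H T j l) + ell2_create j f))"


section \<open>Liftings and the operator \<open>W\<^sup>*\<close>\<close>

text \<open>The block form says that the compression of \<open>E\<^sub>j\<close> to \<open>HC\<close> is \<open>C\<^sub>j\<close> and that the orthogonal
  complement of \<open>HC\<close> is invariant.\<close>

definition coisometric_lifting ::
    "'a::complex_hilbert set \<Rightarrow> ('d::finite \<Rightarrow> 'a \<Rightarrow> 'a) \<Rightarrow> 'a set \<Rightarrow> ('d \<Rightarrow> 'a \<Rightarrow> 'a) \<Rightarrow> bool"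
  where "coisometric_lifting HC C HE E \<longleftrightarrow> HC \<subseteq> HE \<and> coisometric HE E \<and>
    (\<forall>j. (\<forall>x\<in>HC. orth_proj HC (E j x) = C j x) \<and> (\<forall>x\<in>HE \<ominus> HC. E j x \<in> HE \<ominus> HC))"

text \<open>The stage spaces \<open>H \<otimes> P\<^sub>[\<^sub>1\<^sub>,\<^sub>n\<^sub>] \<oplus> \<Oplus>\<^bsub>m \<ge> n\<^esub> (\<complex>\<^sup>d)\<^sup>\<otimes>\<^sup>m \<otimes> D\<close> all live in one
  type: the first component is a family supported on the words of length \<open>n\<close>, where the word
  \<open>[j\<^sub>1, \<dots>, j\<^sub>n]\<close> indexes \<open>\<epsilon>\<^bsub>j\<^sub>1\<^esub> \<otimes> \<dots> \<otimes> \<epsilon>\<^bsub>j\<^sub>n\<^esub>\<close>, and the second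
  component is a family supported on the words of length at least \<open>n\<close>.\<close>

type_synonym ('a, 'd) stage = "('d list, 'a) ell2 \<times> ('d list, 'a ^ 'd) ell2"

definition stage_space ::
    "'a::complex_hilbert set \<Rightarrow> ('d::finite \<Rightarrow> 'a \<Rightarrow> 'a) \<Rightarrow> nat \<Rightarrow> ('a, 'd) stage set"
  where "stage_space H T n = {(h, y).
    (\<forall>w. ell2_nth h w \<in> H \<and> (length w \<noteq> n \<longrightarrow> ell2_nth h w = 0)) \<and>
    (\<forall>\<alpha>. ell2_nth y \<alpha> \<in> defect_space H T \<and> (length \<alpha> < n \<longrightarrow> ell2_nth y \<alpha> = 0))}"

text \<open>The unitary from stage \<open>n - 1\<close> to stage \<open>n\<close>, for \<open>n \<ge> 1\<close>.\<close>

definition stage_unitary ::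
    "'a::complex_hilbert set \<Rightarrow> ('d::finite \<Rightarrow> 'a \<Rightarrow> 'a) \<Rightarrow> nat \<Rightarrow> ('a, 'd) stage \<Rightarrow> ('a, 'd) stage"
  where "stage_unitary H T n = (\<lambda>(h, y).
    (\<Sum>w | length w = n - 1. \<Sum>j\<in>UNIV. ell2_single (w @ [j])
       (adjoint_on H (T j) (ell2_nth h w) + adjoint_on H (defect_comp H T j) (ell2_nth y w)),
     ell2_restrict {\<alpha>. n \<le> length \<alpha>} y))"

text \<open>\<open>stage_up H T n\<close> is \<open>U\<^sub>n \<dots> U\<^sub>1\<close> and \<open>stage_down H T n\<close> is \<open>U\<^sub>1\<^sup>* \<dots> U\<^sub>n\<^sup>*\<close>; stage \<open>0\<close> is the
  dilation space after identifying \<open>H \<otimes> \<complex>\<close> with \<open>H\<close>.\<close>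

primrec stage_up ::
    "'a::complex_hilbert set \<Rightarrow> ('d::finite \<Rightarrow> 'a \<Rightarrow> 'a) \<Rightarrow> nat \<Rightarrow> ('a, 'd) dil \<Rightarrow> ('a, 'd) stage"
  where
    "stage_up H T 0 x = (ell2_single [] (fst x), snd x)"
  | "stage_up H T (Suc n) x = stage_unitary H T (Suc n) (stage_up H T n x)"

primrec stage_down ::
    "'a::complex_hilbert set \<Rightarrow> ('d::finite \<Rightarrow> 'a \<Rightarrow> 'a) \<Rightarrow> nat \<Rightarrow> ('a, 'd) stage \<Rightarrow> ('a, 'd) dil"
  where
    "stage_down H T 0 k = (ell2_nth (fst k) [], snd k)"
  | "stage_down H T (Suc n) k =
      stage_down H T n (adjoint_on (stage_space H T n) (stage_unitary H T (Suc n)) k)"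

definition Q_proj ::
    "'a::complex_hilbert set \<Rightarrow> ('d::finite \<Rightarrow> 'a \<Rightarrow> 'a) \<Rightarrow> nat \<Rightarrow> ('a, 'd) dil \<Rightarrow> ('a, 'd) dil"
  where "Q_proj H T n = orth_proj
    {(l, f) \<in> dilation_space H T. \<forall>\<alpha>. n \<le> length \<alpha> \<longrightarrow> ell2_nth f \<alpha> = 0}"

text \<open>After \<open>Q_proj\<close>, the \<open>n\<close>-th stage consists of vectors in \<open>HC \<otimes> P\<^sub>[\<^sub>1\<^sub>,\<^sub>n\<^sub>]\<close>; these lie in the
  stage spaces of both \<open>C\<close> and \<open>E\<close>, since \<open>HC \<subseteq> HE\<close>.\<close>

definition What_star ::
    "'a::complex_hilbert set \<Rightarrow> ('d::finite \<Rightarrow> 'a \<Rightarrow> 'a) \<Rightarrow> 'a set \<Rightarrow> ('d \<Rightarrow> 'a \<Rightarrow> 'a)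
      \<Rightarrow> ('a, 'd) dil \<Rightarrow> ('a, 'd) dil"
  where "What_star HC C HE E x =
    lim (\<lambda>n. stage_down HE E n (stage_up HC C n (Q_proj HC C n x)))"

definition W_star ::
    "'a::complex_hilbert set \<Rightarrow> ('d::finite \<Rightarrow> 'a \<Rightarrow> 'a) \<Rightarrow> 'a set \<Rightarrow> ('d \<Rightarrow> 'a \<Rightarrow> 'a)
      \<Rightarrow> ('d list, 'a ^ 'd) ell2 \<Rightarrow> ('a, 'd) dil"
  where "W_star HC C HE E f = What_star HC C HE E (0, f)"

end

theory Submission
  imports Defs
begin

text \<open>For a coisometric tuple \<open>T\<close> on \<open>H\<close> the row operator \<open>H\<^sup>d \<rightarrow> H\<close> has \<open>T T\<^sup>* = I\<close>, so
  \<open>D\<^sub>T = I - T\<^sup>* T\<close> is the projection onto the kernel of \<open>T\<close>, the defect space is this kernel, and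
  \<open>v \<mapsto> (T v, D\<^sub>T v)\<close> is a unitary from \<open>H\<^sup>d\<close> onto \<open>H \<oplus> D\<^sub>T\<close> with inverse \<open>(h, y) \<mapsto> T\<^sup>* h + y\<close>
  (\<open>row_adjoint_plus_defect\<close>, \<open>cinner_row_op_defect\<close>, \<open>cinner_row_adjoint_plus\<close>). The dilation and
  the stage unitaries are both made of this one map, and the theorem rests on two computations
  with it.

  The operator \<open>W\<^sup>*\<close> is explicit on the vacuum. The first stage turns \<open>e\<^sub>\<emptyset> \<otimes> d\<close> with \<open>d\<close> in the
  defect space of \<open>C\<close> into \<open>\<Sum>\<^sub>j d\<^sub>j \<otimes> \<epsilon>\<^sub>j\<close>. Because \<open>E\<^sub>j\<^sup>*\<close> restricts to \<open>C\<^sub>j\<^sup>*\<close> on \<open>HC\<close>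
  (\<open>row_adjoint_lift\<close>), all later steps up with \<open>C\<close> and down with \<open>E\<close> cancel. The defining
  sequence is therefore eventually constant, with the value
  \<open>W\<^sup>* (e\<^sub>\<emptyset> \<otimes> d) = (E d, e\<^sub>\<emptyset> \<otimes> D\<^sub>E d)\<close> (\<open>W_star_vacuum\<close>).

  The wandering part of the row isometry on \<open>L = HA \<oplus> \<Gamma> \<otimes> D\<^sub>E\<close> is the set of the same vectors. The
  image of \<open>v \<in> HE\<^sup>d\<close>, namely \<open>(E v, e\<^sub>\<emptyset> \<otimes> D\<^sub>E v)\<close>, is orthogonal to all \<open>V\<^sub>j L\<close> exactly if
  \<open>v \<in> HC\<^sup>d\<close>, and it then lies in \<open>L\<close> exactly if the compression \<open>C v\<close> of \<open>E v\<close> to \<open>HC\<close> vanishes,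
  that is, if \<open>v\<close> is in the defect space of \<open>C\<close> (\<open>wandering_part_L\<close>).

  What is left holds for every row isometry: the complement of the ranges is wandering and generates
  the least invariant subspace containing it, and any wandering subspace is recovered as
  the wandering part of the shift that it generates (\<open>wandering_wandering_part\<close>, \<open>word_sum_minimal\<close>,
  \<open>wandering_part_word_sum\<close>). For \<open>e\<^sub>\<emptyset> \<otimes> D\<^sub>E\<close> wandering is clear, because the dilation acts on
  \<open>\<Gamma> \<otimes> D\<^sub>E\<close> by creation operators. Since adjoints and projections are defined by unique descriptions,
  their existence comes from the projection theorem and the Riesz representation, proved here for
  closed subspaces.\<close>

section \<open>Inner products and closed subspaces\<close>

lemma cinner_add_left: "cinner (x + y) z = cinner x z + cinner y z"
  for x :: "'a::complex_hilbert"
  by (metis cinner_commute cinner_add_right complex_cnj_add)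

lemma cinner_scaleC_left: "cinner (c *\<^sub>C x) y = cnj c * cinner x y"
  for x :: "'a::complex_hilbert"
  by (metis cinner_commute cinner_scaleC_right complex_cnj_mult)

lemma cinner_zero_right [simp]: "cinner x 0 = 0" for x :: "'a::complex_hilbert"
  using cinner_add_right[of x 0 0] by simp

lemma cinner_zero_left [simp]: "cinner 0 x = 0" for x :: "'a::complex_hilbert"
  using cinner_add_left[of 0 0 x] by simp

lemma cinner_diff_right: "cinner x (y - z) = cinner x y - cinner x z"
  for x :: "'a::complex_hilbert"
  using cinner_add_right[of x "y - z" z] by simp

lemma cinner_diff_left: "cinner (x - y) z = cinner x z - cinner y z"
  for x :: "'a::complex_hilbert"
  using cinner_add_left[of "x - y" y z] by simp

lemma cinner_sum_right: "cinner x (\<Sum>i\<in>I. f i) = (\<Sum>i\<in>I. cinner x (f i))"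
  for x :: "'a::complex_hilbert"
  by (induction I rule: infinite_finite_induct) (auto simp: cinner_add_right)

lemma cinner_sum_left: "cinner (\<Sum>i\<in>I. f i) x = (\<Sum>i\<in>I. cinner (f i) x)"
  for x :: "'a::complex_hilbert"
  by (induction I rule: infinite_finite_induct) (auto simp: cinner_add_left)

lemma cinner_eq_zero_iff [simp]: "cinner x x = 0 \<longleftrightarrow> x = 0" for x :: "'a::complex_hilbert"
  by (simp add: cinner_self)

lemma cinner_eq_zero_commute: "cinner x y = 0 \<longleftrightarrow> cinner y x = 0" for x :: "'a::complex_hilbert"
  by (metis cinner_commute complex_cnj_zero)

lemma scaleC_minus_one [simp]: "(-1) *\<^sub>C x = - x" for x :: "'a::complex_hilbert"
  using scaleC_of_real[of "-1" x] by simp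

lemma scaleC_zero_right [simp]: "c *\<^sub>C 0 = 0" for c :: complex
  using scaleC_add_right[of c 0 0] by simp

lemma scaleC_sum_right: "c *\<^sub>C (\<Sum>i\<in>I. f i) = (\<Sum>i\<in>I. c *\<^sub>C f i)"
  for f :: "_ \<Rightarrow> 'a::complex_hilbert"
  by (induction I rule: infinite_finite_induct) (auto simp: scaleC_add_right)

lemma cinner_axis_left: "cinner (axis j x) v = cinner x (v $ j)"
proof -
  have "cinner (axis j x) v = (\<Sum>i\<in>UNIV. if i = j then cinner x (v $ i) else 0)"
    unfolding cinner_vec_def by (rule sum.cong) (auto simp: axis_def)
  then show ?thesis by simp
qed

lemma csubspace_0: "csubspace S \<Longrightarrow> 0 \<in> S"
  and csubspace_add: "csubspace S \<Longrightarrow> x \<in> S \<Longrightarrow> y \<in> S \<Longrightarrow> x + y \<in> S"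
  and csubspace_scaleC: "csubspace S \<Longrightarrow> x \<in> S \<Longrightarrow> c *\<^sub>C x \<in> S"
  by (auto simp: csubspace_def)

lemma csubspace_diff: "csubspace S \<Longrightarrow> x \<in> S \<Longrightarrow> y \<in> S \<Longrightarrow> x - y \<in> S"
  using csubspace_add[of S x "(-1) *\<^sub>C y"] csubspace_scaleC[of S y "-1"] by simp

lemma csubspace_sum: "csubspace S \<Longrightarrow> (\<And>i. i \<in> I \<Longrightarrow> f i \<in> S) \<Longrightarrow> (\<Sum>i\<in>I. f i) \<in> S"
  by (induction I rule: infinite_finite_induct) (auto simp: csubspace_0 csubspace_add)

lemma csubspace_scaleR: "csubspace S \<Longrightarrow> x \<in> S \<Longrightarrow> r *\<^sub>R x \<in> S"
  using csubspace_scaleC[of S x "complex_of_real r"] by (simp add: scaleC_of_real)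

lemma closed_csubspaceD: "closed_csubspace S \<Longrightarrow> csubspace S" "closed_csubspace S \<Longrightarrow> closed S"
  by (auto simp: closed_csubspace_def)

lemma closed_csubspace_UNIV: "closed_csubspace UNIV"
  by (auto simp: closed_csubspace_def csubspace_def)

lemma closed_csubspace_singleton: "closed_csubspace {0}"
  by (auto simp: closed_csubspace_def csubspace_def)

lemma closed_csubspace_Inter: "(\<And>S. S \<in> \<S> \<Longrightarrow> closed_csubspace S) \<Longrightarrow> closed_csubspace (\<Inter>\<S>)"
  by (auto simp: closed_csubspace_def csubspace_def)

lemma closed_csubspace_Int: "closed_csubspace S \<Longrightarrow> closed_csubspace T \<Longrightarrow> closed_csubspace (S \<inter> T)"
  using closed_csubspace_Inter[of "{S, T}"] by auto

lemma closed_csubspace_Times: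
  "closed_csubspace S \<Longrightarrow> closed_csubspace T \<Longrightarrow> closed_csubspace (S \<times> T)"
  by (auto simp: closed_csubspace_def csubspace_def closed_Times scaleC_prod_def zero_prod_def)

lemma csubspace_hull: "csubspace (csubspace hull A)"
  by (rule hull_in) (auto simp: csubspace_def)

lemma csubspace_closure:
  assumes "csubspace S"
  shows "csubspace (closure S)"
  unfolding csubspace_def
proof (intro conjI ballI allI)
  show "0 \<in> closure S"
    using csubspace_0[OF assms] closure_subset by blast
next
  fix x y assume "x \<in> closure S" "y \<in> closure S"
  then obtain f g where "\<And>n. f n \<in> S" "f \<longlonglongrightarrow> x" "\<And>n. g n \<in> S" "g \<longlonglongrightarrow> y"
    by (auto simp: closure_sequential)
  then show "x + y \<in> closure S"
    using csubspace_add[OF assms] unfolding closure_sequential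
    by (intro exI[of _ "\<lambda>n. f n + g n"]) (auto intro: tendsto_intros)
next
  fix c x assume "x \<in> closure S"
  then obtain f where f: "\<And>n. f n \<in> S" "f \<longlonglongrightarrow> x"
    by (auto simp: closure_sequential)
  have "bounded_linear (\<lambda>x. c *\<^sub>C x :: 'a)"
  proof (rule bounded_linear_intro[of _ "cmod c"])
    show "c *\<^sub>C (r *\<^sub>R x) = r *\<^sub>R (c *\<^sub>C x)" for r and x :: 'a
      by (simp add: scaleC_scaleC mult.commute flip: scaleC_of_real)
  qed (simp_all add: scaleC_add_right norm_scaleC mult.commute)
  then have "(\<lambda>n. c *\<^sub>C f n) \<longlonglongrightarrow> c *\<^sub>C x"
    using f(2) by (rule bounded_linear.tendsto)
  then show "c *\<^sub>C x \<in> closure S"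
    using csubspace_scaleC[OF assms] f(1) unfolding closure_sequential
    by (intro exI[of _ "\<lambda>n. c *\<^sub>C f n"]) auto
qed

lemma closed_csubspace_ccspan: "closed_csubspace (ccspan A)"
  by (simp add: ccspan_def closed_csubspace_def csubspace_closure csubspace_hull)

lemma ccspan_superset: "A \<subseteq> ccspan A"
  unfolding ccspan_def by (meson closure_subset hull_subset order_trans)

lemma ccspan_minimal: "closed_csubspace M \<Longrightarrow> A \<subseteq> M \<Longrightarrow> ccspan A \<subseteq> M"
  unfolding ccspan_def closed_csubspace_def by (simp add: closure_minimal hull_minimal)


section \<open>Bounded operators, orthogonal projections and adjoints\<close>

lemma bounded_clinear_onI:
  assumes "\<And>x. x \<in> A \<Longrightarrow> T x \<in> B"
    and "\<And>x y. x \<in> A \<Longrightarrow> y \<in> A \<Longrightarrow> T (x + y) = T x + T y"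
    and "\<And>c x. x \<in> A \<Longrightarrow> T (c *\<^sub>C x) = c *\<^sub>C T x"
    and "\<And>x. x \<in> A \<Longrightarrow> norm (T x) \<le> K * norm x"
  shows "bounded_clinear_on A B T"
  using assms unfolding bounded_clinear_on_def by blast

lemma bounded_clinear_onD:
  assumes "bounded_clinear_on A B T"
  shows "x \<in> A \<Longrightarrow> T x \<in> B"
    and "x \<in> A \<Longrightarrow> y \<in> A \<Longrightarrow> T (x + y) = T x + T y"
    and "x \<in> A \<Longrightarrow> T (c *\<^sub>C x) = c *\<^sub>C T x"
  using assms unfolding bounded_clinear_on_def by auto

lemma bounded_clinear_on_diff:
  assumes "bounded_clinear_on A B T" "csubspace A" "x \<in> A" "y \<in> A"
  shows "T (x - y) = T x - T y"
  using bounded_clinear_onD(2)[OF assms(1), of "x - y" y] csubspace_diff[OF assms(2-4)] assms(4)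
  by simp

lemma bounded_clinear_on_zero:
  assumes "bounded_clinear_on A B T" "csubspace A"
  shows "T 0 = 0"
  using bounded_clinear_on_diff[OF assms csubspace_0 csubspace_0] assms by simp

lemma bounded_clinear_on_bound:
  assumes "bounded_clinear_on A B T"
  obtains K where "0 \<le> K" "\<And>x. x \<in> A \<Longrightarrow> norm (T x) \<le> K * norm x"
proof -
  obtain K where K: "\<And>x. x \<in> A \<Longrightarrow> norm (T x) \<le> K * norm x"
    using assms unfolding bounded_clinear_on_def by blast
  have "norm (T x) \<le> max 0 K * norm x" if "x \<in> A" for x
    using K[OF that] mult_right_mono[of K "max 0 K" "norm x"] by simp
  then show thesis by (rule that[rotated]) auto
qed

lemma bounded_clinear_on_mono:
  "bounded_clinear_on A B T \<Longrightarrow> A' \<subseteq> A \<Longrightarrow> T ` A' \<subseteq> B' \<Longrightarrow> bounded_clinear_on A' B' T"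
  unfolding bounded_clinear_on_def by (auto; blast)

lemma bounded_clinear_on_tendsto:
  assumes T: "bounded_clinear_on A B T" and A: "csubspace A"
    and f: "\<And>n. f n \<in> A" "f \<longlonglongrightarrow> x" "x \<in> A"
  shows "(\<lambda>n. T (f n)) \<longlonglongrightarrow> T x"
proof -
  obtain K where K: "\<And>x. x \<in> A \<Longrightarrow> norm (T x) \<le> K * norm x"
    using T by (rule bounded_clinear_on_bound) blast
  have "(\<lambda>n. T (f n) - T x) \<longlonglongrightarrow> 0"
  proof (rule Lim_null_comparison)
    show "\<forall>\<^sub>F n in sequentially. norm (T (f n) - T x) \<le> K * norm (f n - x)"
      using K[OF csubspace_diff[OF A f(1) f(3)]] bounded_clinear_on_diff[OF T A f(1) f(3)] by simp
    have "(\<lambda>n. K * norm (f n - x)) \<longlonglongrightarrow> K * norm (x - x)"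
      by (intro tendsto_intros f(2))
    then show "(\<lambda>n. K * norm (f n - x)) \<longlonglongrightarrow> 0" by simp
  qed
  then show ?thesis by (simp add: LIM_zero_iff)
qed

text \<open>Kernels, orthogonal complements, coordinate subspaces and the sets on which an operator maps
  into a given subspace all arise as preimages, which is how their closedness is obtained.\<close>

lemma closed_csubspace_preimage:
  assumes T: "bounded_clinear_on A B T" and A: "closed_csubspace A" and M: "closed_csubspace M"
  shows "closed_csubspace {x \<in> A. T x \<in> M}"
  unfolding closed_csubspace_def
proof
  note A' = closed_csubspaceD[OF A] and M' = closed_csubspaceD[OF M]
  show "csubspace {x \<in> A. T x \<in> M}"
    using A'(1) M'(1) bounded_clinear_on_zero[OF T A'(1)] bounded_clinear_onD(2,3)[OF T]
    by (auto simp: csubspace_def)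
  show "closed {x \<in> A. T x \<in> M}"
    unfolding closed_sequential_limits
  proof clarify
    fix f x assume f: "\<forall>n. f n \<in> {x \<in> A. T x \<in> M}" "f \<longlonglongrightarrow> x"
    then have x: "x \<in> A"
      using closed_sequentially[OF A'(2)] by blast
    then have "(\<lambda>n. T (f n)) \<longlonglongrightarrow> T x"
      using f by (intro bounded_clinear_on_tendsto[OF T A'(1)]) auto
    then have "T x \<in> M"
      using closed_sequentially[OF M'(2), of "\<lambda>n. T (f n)"] f(1) by blast
    with x show "x \<in> A \<and> T x \<in> M" ..
  qed
qed

lemma bounded_clinear_on_cinner: "bounded_clinear_on UNIV UNIV (cinner y)"
  for y :: "'a::complex_hilbert"
  by (rule bounded_clinear_onI[of _ _ _ "2 * norm y"])
    (auto simp: cinner_add_right cinner_scaleC_right scaleC_complex_def mult.assoc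
      intro: order_trans[OF cmod_cinner_le])

lemma closed_csubspace_orth_minus:
  assumes "closed_csubspace L"
  shows "closed_csubspace (L \<ominus> M)"
proof -
  have "L \<ominus> M = \<Inter>(insert L ((\<lambda>y. {x \<in> UNIV. cinner y x \<in> {0}}) ` M))"
    unfolding orth_minus_def by auto
  also have "closed_csubspace \<dots>"
    using assms closed_csubspace_preimage[OF bounded_clinear_on_cinner closed_csubspace_UNIV
        closed_csubspace_singleton]
    by (intro closed_csubspace_Inter) auto
  finally show ?thesis .
qed

lemma orth_minus_ccspan: "L \<ominus> ccspan A = L \<ominus> A"
proof
  show "L \<ominus> ccspan A \<subseteq> L \<ominus> A"
    using ccspan_superset[of A] by (auto simp: orth_minus_def)
  show "L \<ominus> A \<subseteq> L \<ominus> ccspan A"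
  proof
    fix x assume x: "x \<in> L \<ominus> A"
    have "ccspan A \<subseteq> UNIV \<ominus> {x}"
      using x by (intro ccspan_minimal closed_csubspace_orth_minus closed_csubspace_UNIV)
        (auto simp: orth_minus_def cinner_eq_zero_commute[of x])
    with x show "x \<in> L \<ominus> ccspan A"
      by (auto simp: orth_minus_def cinner_eq_zero_commute[of x])
  qed
qed

lemma orthogonal_self:
  assumes "csubspace M" "x \<in> M" "y \<in> M" "\<And>z. z \<in> M \<Longrightarrow> cinner z (x - y) = 0"
  shows "x = y"
  using assms(4)[OF csubspace_diff[OF assms(1-3)]] by simp

text \<open>The nearest point exists because the parallelogram law makes every minimizing sequence a
  Cauchy sequence; orthogonality is the first-order condition at the minimum.\<close>

theorem orthogonal_projection_exists:
  fixes M :: "'a::complex_hilbert set"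
  assumes M: "closed_csubspace M"
  obtains y where "y \<in> M" "\<And>z. z \<in> M \<Longrightarrow> cinner z (x - y) = 0"
proof -
  note M' = closed_csubspaceD[OF M]
  define d where "d = Inf ((\<lambda>y. (norm (x - y))\<^sup>2) ` M)"
  have bdd: "bdd_below ((\<lambda>y. (norm (x - y))\<^sup>2) ` M)"
    by (rule bdd_belowI[of _ 0]) auto
  have d: "d \<le> (norm (x - y))\<^sup>2" if "y \<in> M" for y
    unfolding d_def using that bdd by (intro cInf_lower) auto
  have "\<exists>y\<in>M. (norm (x - y))\<^sup>2 < d + inverse (real (Suc n))" for n
  proof (rule ccontr)
    assume "\<not> (\<exists>y\<in>M. (norm (x - y))\<^sup>2 < d + inverse (real (Suc n)))"
    then have "d + inverse (real (Suc n)) \<le> d"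
      using csubspace_0[OF M'(1)] unfolding d_def by (intro cInf_greatest) (auto simp: not_less)
    then show False by simp
  qed
  then obtain f where f: "\<And>n. f n \<in> M" "\<And>n. (norm (x - f n))\<^sup>2 < d + inverse (real (Suc n))"
    by metis
  have "Cauchy f"
  proof (rule CauchyI)
    fix e :: real assume "0 < e"
    then obtain N where N: "inverse (real (Suc N)) < e\<^sup>2 / 4"
      using reals_Archimedean[of "e\<^sup>2 / 4"] by auto
    have "norm (f m - f n) < e" if "m \<ge> N" "n \<ge> N" for m n
    proof (rule power2_less_imp_less)
      have "(1 / 2) *\<^sub>R (f m + f n) \<in> M"
        by (intro csubspace_scaleR csubspace_add M' f)
      then have mid: "d \<le> (norm (x - (1 / 2) *\<^sub>R (f m + f n)))\<^sup>2" by (rule d)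
      have "(norm (f m - f n))\<^sup>2
        = 2 * (norm (x - f m))\<^sup>2 + 2 * (norm (x - f n))\<^sup>2 - 4 * (norm (x - (1 / 2) *\<^sub>R (f m + f n)))\<^sup>2"
        by (simp add: power2_norm_eq_inner inner_simps inner_commute algebra_simps)
      also have "\<dots> \<le> 2 * (norm (x - f m))\<^sup>2 + 2 * (norm (x - f n))\<^sup>2 - 4 * d"
        using mid by simp
      also have "\<dots> < 2 * inverse (real (Suc m)) + 2 * inverse (real (Suc n))"
        using f(2)[of m] f(2)[of n] by simp
      also have "\<dots> \<le> 2 * inverse (real (Suc N)) + 2 * inverse (real (Suc N))"
        using that by (intro add_mono mult_left_mono le_imp_inverse_le) auto
      also have "\<dots> < e\<^sup>2" using N by simp
      finally show "(norm (f m - f n))\<^sup>2 < e\<^sup>2" .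
    qed (use \<open>0 < e\<close> in simp)
    then show "\<exists>N. \<forall>m\<ge>N. \<forall>n\<ge>N. norm (f m - f n) < e" by blast
  qed
  then obtain y where y: "f \<longlonglongrightarrow> y"
    by (auto simp: Cauchy_convergent_iff convergent_def)
  have yM: "y \<in> M"
    using closed_sequentially[OF M'(2)] f(1) y by blast
  have "(\<lambda>n. (norm (x - f n))\<^sup>2) \<longlonglongrightarrow> (norm (x - y))\<^sup>2"
    by (intro tendsto_intros y)
  moreover have "(\<lambda>n. d + inverse (real (Suc n))) \<longlonglongrightarrow> d + 0"
    by (intro tendsto_intros LIMSEQ_inverse_real_of_nat)
  ultimately have yd: "(norm (x - y))\<^sup>2 \<le> d + 0"
    using f(2) by (intro LIMSEQ_le[of _ _ _ "d + 0"]) (auto intro: less_imp_le)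
  have inner: "inner z (x - y) = 0" if z: "z \<in> M" for z
  proof (cases "z = 0")
    case False
    \<comment> \<open>the step along \<open>z\<close> that minimizes the distance to \<open>x\<close>\<close>
    define t where "t = inner z (x - y) / (norm z)\<^sup>2"
    have t: "t * (norm z)\<^sup>2 = inner z (x - y)"
      using False by (simp add: t_def)
    have "(norm (x - y))\<^sup>2 \<le> (norm (x - (y + t *\<^sub>R z)))\<^sup>2"
      using d[OF csubspace_add[OF M'(1) yM csubspace_scaleR[OF M'(1) z]], of t] yd by linarith
    also have "\<dots> = (norm (x - y))\<^sup>2 - 2 * t * inner z (x - y) + t * (t * (norm z)\<^sup>2)"
      by (simp add: power2_norm_eq_inner inner_simps inner_commute algebra_simps)
    also have "\<dots> = (norm (x - y))\<^sup>2 - t * (t * (norm z)\<^sup>2)"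
      by (simp add: t)
    finally have "(t * norm z)\<^sup>2 \<le> 0"
      by (simp add: power2_eq_square algebra_simps)
    then have "t = 0" using False by simp
    then show ?thesis using t by simp
  qed simp
  have "cinner z (x - y) = 0" if z: "z \<in> M" for z
  proof (rule complex_eqI)
    show "Re (cinner z (x - y)) = Re 0" using inner[OF z] by (simp add: Re_cinner)
    have "Re (cinner (\<i> *\<^sub>C z) (x - y)) = 0"
      using inner[OF csubspace_scaleC[OF M'(1) z]] by (simp add: Re_cinner)
    then show "Im (cinner z (x - y)) = Im 0" by (simp add: cinner_scaleC_left)
  qed
  with yM show thesis by (rule that)
qed

lemma orth_proj_eqI:
  assumes "csubspace M" "y \<in> M" "\<And>z. z \<in> M \<Longrightarrow> cinner z (x - y) = 0"
  shows "orth_proj M x = y"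
  unfolding orth_proj_def
proof (rule the_equality)
  fix y' assume y': "y' \<in> M \<and> (\<forall>z\<in>M. cinner z (x - y') = 0)"
  show "y' = y"
  proof (rule orthogonal_self[OF assms(1)])
    fix z assume "z \<in> M"
    then have "cinner z (x - y) = 0" "cinner z (x - y') = 0"
      using y' assms(3) by auto
    then show "cinner z (y' - y) = 0"
      by (simp add: cinner_diff_right)
  qed (use assms y' in auto)
qed (use assms in auto)

lemma cinner_orth_proj:
  assumes "closed_csubspace M" "z \<in> M"
  shows "cinner z (orth_proj M x) = cinner z x"
proof -
  obtain y where y: "y \<in> M" "\<And>z. z \<in> M \<Longrightarrow> cinner z (x - y) = 0"
    using orthogonal_projection_exists[OF assms(1)] by blast
  then have "orth_proj M x = y"
    by (intro orth_proj_eqI closed_csubspaceD assms)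
  with y(2)[OF assms(2)] show ?thesis by (simp add: cinner_diff_right)
qed

lemma orth_minus_orth_minus:
  assumes L: "csubspace L" and M: "closed_csubspace M" "M \<subseteq> L"
  shows "L \<ominus> (L \<ominus> M) = M"
proof
  show "M \<subseteq> L \<ominus> (L \<ominus> M)"
    using M by (auto simp: orth_minus_def cinner_eq_zero_commute)
  show "L \<ominus> (L \<ominus> M) \<subseteq> M"
  proof
    fix x assume x: "x \<in> L \<ominus> (L \<ominus> M)"
    obtain y where y: "y \<in> M" "\<And>z. z \<in> M \<Longrightarrow> cinner z (x - y) = 0"
      using orthogonal_projection_exists[OF M(1)] by blast
    have "x - y \<in> L \<ominus> M"
      using x y M(2) csubspace_diff[OF L] by (auto simp: orth_minus_def)
    then have "cinner (x - y) x = 0" "cinner (x - y) y = 0"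
      using x y by (auto simp: orth_minus_def cinner_eq_zero_commute)
    then have "cinner (x - y) (x - y) = 0" by (simp add: cinner_diff_right)
    with y show "x \<in> M" by simp
  qed
qed

lemma adjoint_on_eqI:
  assumes "csubspace A" "x \<in> A" "\<And>a. a \<in> A \<Longrightarrow> cinner (T a) y = cinner a x"
  shows "adjoint_on A T y = x"
  unfolding adjoint_on_def
proof (rule the_equality)
  fix x' assume x': "x' \<in> A \<and> (\<forall>a\<in>A. cinner (T a) y = cinner a x')"
  show "x' = x"
    by (rule orthogonal_self[OF assms(1)])
      (use x' assms(2,3) in \<open>auto simp: cinner_diff_right\<close>)
qed (use assms in auto)

text \<open>This is the Riesz representation theorem for the functional \<open>\<lambda>a. cinner y (T a)\<close>: a vector
  \<open>z\<close> orthogonal to its kernel \<open>N\<close> represents it up to a scalar.\<close>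

lemma adjoint_on_exists:
  assumes A: "closed_csubspace A" and T: "bounded_clinear_on A B T"
  obtains x where "x \<in> A" "\<And>a. a \<in> A \<Longrightarrow> cinner (T a) y = cinner a x"
proof -
  note A' = closed_csubspaceD(1)[OF A]
  define \<phi> where "\<phi> a = cinner y (T a)" for a
  note \<phi>_defs = \<phi>_def bounded_clinear_onD[OF T] cinner_add_right cinner_scaleC_right
  have \<phi>_diff: "\<phi> (a - b) = \<phi> a - \<phi> b" if "a \<in> A" "b \<in> A" for a b
    using that by (simp add: \<phi>_def bounded_clinear_on_diff[OF T A'] cinner_diff_right)
  obtain K where K: "0 \<le> K" "\<And>x. x \<in> A \<Longrightarrow> norm (T x) \<le> K * norm x"
    using T by (rule bounded_clinear_on_bound) blast
  have "bounded_clinear_on A UNIV \<phi>"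
  proof (rule bounded_clinear_onI[of _ _ _ "2 * norm y * K"])
    fix x assume "x \<in> A"
    then have "norm y * norm (T x) \<le> norm y * (K * norm x)"
      by (intro mult_left_mono K) auto
    then show "cmod (\<phi> x) \<le> 2 * norm y * K * norm x"
      using cmod_cinner_le[of y "T x"] by (simp add: \<phi>_def algebra_simps)
  qed (auto simp: \<phi>_defs scaleC_complex_def)
  then have N: "closed_csubspace {a \<in> A. \<phi> a \<in> {0}}" (is "closed_csubspace ?N")
    by (rule closed_csubspace_preimage) (auto simp: A closed_csubspace_singleton)
  have "\<exists>x\<in>A. \<forall>a\<in>A. \<phi> a = cinner x a"
  proof (cases "\<forall>a\<in>A. \<phi> a = 0")
    case True
    then show ?thesis using csubspace_0[OF A'] by (intro bexI[of _ 0]) auto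
  next
    case False
    then obtain a0 where a0: "a0 \<in> A" "\<phi> a0 \<noteq> 0" by blast
    obtain n where n: "n \<in> ?N" "\<And>b. b \<in> ?N \<Longrightarrow> cinner b (a0 - n) = 0"
      using orthogonal_projection_exists[OF N] by blast
    define z where "z = a0 - n"
    have z: "z \<in> A" "\<phi> z \<noteq> 0"
      using a0 n(1) \<phi>_diff csubspace_diff[OF A'] by (auto simp: z_def)
    then have "z \<noteq> 0" by (auto simp: \<phi>_def bounded_clinear_on_zero[OF T A'])
    have "\<phi> a = cinner ((cnj (\<phi> z) / cinner z z) *\<^sub>C z) a" if a: "a \<in> A" for a
    proof -
      have "\<phi> z *\<^sub>C a - \<phi> a *\<^sub>C z \<in> ?N"
        using a z csubspace_scaleC[OF A'] csubspace_diff[OF A']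
        by (simp add: \<phi>_diff) (simp add: \<phi>_defs)
      then have "cinner z (\<phi> z *\<^sub>C a - \<phi> a *\<^sub>C z) = 0"
        using n(2) cinner_eq_zero_commute z_def by blast
      then have "\<phi> z * cinner z a = \<phi> a * cinner z z"
        by (simp add: cinner_diff_right cinner_scaleC_right)
      then show ?thesis using \<open>z \<noteq> 0\<close>
        by (simp add: cinner_scaleC_left cinner_commute[of z z, symmetric] field_simps)
    qed
    then show ?thesis using z csubspace_scaleC[OF A'] by blast
  qed
  then obtain x where "x \<in> A" and x: "\<And>a. a \<in> A \<Longrightarrow> \<phi> a = cinner x a" by blast
  have "cinner (T a) y = cinner a x" if "a \<in> A" for a
    using x[OF that] unfolding \<phi>_def by (metis cinner_commute)
  with \<open>x \<in> A\<close> show thesis by (rule that)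
qed

lemma adjoint_on:
  assumes "closed_csubspace A" "bounded_clinear_on A B T"
  shows "adjoint_on A T y \<in> A"
    and "a \<in> A \<Longrightarrow> cinner (T a) y = cinner a (adjoint_on A T y)"
proof -
  obtain x where x: "x \<in> A" "\<And>a. a \<in> A \<Longrightarrow> cinner (T a) y = cinner a x"
    using adjoint_on_exists[OF assms] by blast
  have "adjoint_on A T y = x"
    by (intro adjoint_on_eqI closed_csubspaceD assms x)
  with x show "adjoint_on A T y \<in> A" "a \<in> A \<Longrightarrow> cinner (T a) y = cinner a (adjoint_on A T y)"
    by auto
qed


section \<open>Row isometries and their wandering subspaces\<close>

lemma isometry_cinner:
  assumes T: "bounded_clinear_on A B T" and A: "csubspace A"
    and iso: "\<And>x. x \<in> A \<Longrightarrow> norm (T x) = norm x" and "x \<in> A" "y \<in> A"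
  shows "cinner (T x) (T y) = cinner x y"
proof (rule complex_eqI)
  have inner: "inner (T x) (T y) = inner x y" if "x \<in> A" "y \<in> A" for x y
    using iso[OF that(1)] iso[OF that(2)] iso[OF csubspace_add[OF A that]]
    by (simp add: dot_norm bounded_clinear_onD(2)[OF T that])
  show "Re (cinner (T x) (T y)) = Re (cinner x y)"
    using inner assms(4,5) by (simp add: Re_cinner)
  have "Re (cinner (\<i> *\<^sub>C T x) (T y)) = Re (cinner (\<i> *\<^sub>C x) y)"
    using inner[OF csubspace_scaleC[OF A assms(4)] assms(5), of \<i>] bounded_clinear_onD(3)[OF T assms(4)]
    by (simp add: Re_cinner)
  then show "Im (cinner (T x) (T y)) = Im (cinner x y)"
    by (simp add: cinner_scaleC_left)
qed

lemma row_isometryD: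
  assumes "row_isometry L V"
  shows "bounded_clinear_on L L (V j)"
    and "x \<in> L \<Longrightarrow> norm (V j x) = norm x"
    and "i \<noteq> j \<Longrightarrow> x \<in> L \<Longrightarrow> y \<in> L \<Longrightarrow> cinner (V i x) (V j y) = 0"
  using assms unfolding row_isometry_def by auto

lemma row_isometry_image: "row_isometry L V \<Longrightarrow> V j ` L \<subseteq> L"
  unfolding row_isometry_def bounded_clinear_on_def by blast

lemma row_isometry_cinner:
  assumes "row_isometry L V" "csubspace L" "x \<in> L" "y \<in> L"
  shows "cinner (V i x) (V j y) = (if i = j then cinner x y else 0)"
  using isometry_cinner[OF row_isometryD(1)[OF assms(1)] assms(2)] row_isometryD(2,3)[OF assms(1)]
    assms(3,4) by auto

lemma row_isometry_subset:
  assumes "row_isometry L V" "M \<subseteq> L" "\<And>j. V j ` M \<subseteq> M"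
  shows "row_isometry M V"
  unfolding row_isometry_def
  using bounded_clinear_on_mono[OF row_isometryD(1)[OF assms(1)] assms(2,3)]
    row_isometryD(2,3)[OF assms(1)] subsetD[OF assms(2)] by simp

lemma word_op_in: "x \<in> L \<Longrightarrow> (\<And>j. V j ` L \<subseteq> L) \<Longrightarrow> word_op V \<alpha> x \<in> L"
  by (induction \<alpha>) auto

lemma wandering_part_eq:
  "wandering_part L V = {x \<in> L. \<forall>j. \<forall>y\<in>L. cinner (V j y) x = 0}"
  unfolding wandering_part_def orth_minus_ccspan by (auto simp: orth_minus_def)

lemma wanderingD:
  assumes "wandering L V M"
  shows "closed_csubspace M" and "M \<subseteq> L"
    and "\<alpha> \<noteq> \<beta> \<Longrightarrow> x \<in> M \<Longrightarrow> y \<in> M \<Longrightarrow> cinner (word_op V \<alpha> x) (word_op V \<beta> y) = 0"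
  using assms unfolding wandering_def by - (elim conjE, assumption, elim conjE, assumption, metis)

lemma wandering_subset: "wandering L V M \<Longrightarrow> M \<subseteq> L' \<Longrightarrow> wandering L' V M"
  unfolding wandering_def by (elim conjE, intro conjI; assumption)

text \<open>Cancelling the common prefix of two distinct words leaves either different first letters, whose
  ranges are orthogonal anyway, or one empty word. So only the latter case has to be checked.\<close>

lemma wanderingI:
  assumes L: "csubspace L" "row_isometry L V" and M: "closed_csubspace M" "M \<subseteq> L"
    and orth: "\<And>j \<alpha> x y. x \<in> M \<Longrightarrow> y \<in> M \<Longrightarrow> cinner (V j (word_op V \<alpha> x)) y = 0"
  shows "wandering L V M"
  unfolding wandering_def
proof (intro conjI M allI impI ballI)
  fix \<alpha> \<beta> :: "'b list" and x y assume "\<alpha> \<noteq> \<beta>" and xy: "x \<in> M" "y \<in> M"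
  note V = row_isometry_image[OF L(2)]
  have mem: "word_op V \<gamma> z \<in> L" if "z \<in> M" for \<gamma> z
    using that M(2) by (intro word_op_in V) auto
  show "cinner (word_op V \<alpha> x) (word_op V \<beta> y) = 0"
    using \<open>\<alpha> \<noteq> \<beta>\<close>
  proof (induction \<alpha> arbitrary: \<beta>)
    case Nil
    then obtain j \<gamma> where "\<beta> = j # \<gamma>" by (cases \<beta>) auto
    then show ?case using orth[OF xy(2,1)] by (simp add: cinner_eq_zero_commute)
  next
    case (Cons i \<alpha>)
    show ?case
    proof (cases \<beta>)
      case Nil
      then show ?thesis using orth[OF xy] by simp
    next
      case (Cons j \<gamma>)
      have "cinner (word_op V \<alpha> x) (word_op V \<gamma> y) = 0" if "i = j"
        using Cons.IH Cons.prems Cons that by blast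
      then show ?thesis
        using Cons by (simp add: row_isometry_cinner[OF L(2,1) mem[OF xy(1)] mem[OF xy(2)]])
    qed
  qed
qed

lemma wandering_wandering_part:
  assumes L: "closed_csubspace L" "row_isometry L V"
  shows "wandering L V (wandering_part L V)"
proof (rule wanderingI[OF closed_csubspaceD(1)[OF L(1)] L(2)])
  note V = row_isometry_image[OF L(2)]
  show "closed_csubspace (wandering_part L V)"
    unfolding wandering_part_def by (rule closed_csubspace_orth_minus[OF L(1)])
  show "wandering_part L V \<subseteq> L" by (auto simp: wandering_part_eq)
  fix j \<alpha> x y assume xy: "x \<in> wandering_part L V" "y \<in> wandering_part L V"
  have "word_op V \<alpha> x \<in> L"
    by (rule word_op_in[OF _ V]) (use xy in \<open>simp add: wandering_part_eq\<close>)
  then show "cinner (V j (word_op V \<alpha> x)) y = 0"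
    using xy(2) by (simp add: wandering_part_eq)
qed

lemma closed_csubspace_word_sum: "closed_csubspace (word_sum V M)"
  unfolding word_sum_def by (rule closed_csubspace_ccspan)

lemma word_op_in_word_sum: "x \<in> M \<Longrightarrow> word_op V \<alpha> x \<in> word_sum V M"
  unfolding word_sum_def by (intro subsetD[OF ccspan_superset] UN_I[of \<alpha>] imageI) auto

lemma subset_word_sum: "M \<subseteq> word_sum V M"
  using word_op_in_word_sum[of _ M V "[]"] by auto

lemma word_sum_minimal:
  assumes "invariant V N" "M \<subseteq> N"
  shows "word_sum V M \<subseteq> N"
  unfolding word_sum_def
proof (rule ccspan_minimal)
  show "(\<Union>\<alpha>. word_op V \<alpha> ` M) \<subseteq> N"
  proof clarify
    fix \<alpha> x assume "x \<in> M"
    with assms show "word_op V \<alpha> x \<in> N"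
      by (intro word_op_in) (auto simp: invariant_def)
  qed
qed (use assms in \<open>simp add: invariant_def\<close>)

lemma word_sum_subset:
  assumes "closed_csubspace L" "row_isometry L V" "M \<subseteq> L"
  shows "word_sum V M \<subseteq> L"
  by (rule word_sum_minimal) (use assms row_isometry_image[OF assms(2)] in \<open>simp_all add: invariant_def\<close>)

lemma invariant_word_sum:
  assumes L: "closed_csubspace L" "row_isometry L V" and M: "M \<subseteq> L"
  shows "invariant V (word_sum V M)"
  unfolding invariant_def
proof (intro conjI allI closed_csubspace_word_sum)
  fix j
  let ?N = "{x \<in> L. V j x \<in> word_sum V M}"
  have "closed_csubspace ?N"
    using row_isometryD(1)[OF L(2)] L(1) closed_csubspace_word_sum
    by (rule closed_csubspace_preimage)
  have "word_op V \<alpha> x \<in> ?N" if "x \<in> M" for \<alpha> x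
    using word_op_in_word_sum[OF that, of V "j # \<alpha>"]
      subsetD[OF word_sum_subset[OF L M] word_op_in_word_sum[OF that, of V \<alpha>]] by simp
  then have "(\<Union>\<alpha>. word_op V \<alpha> ` M) \<subseteq> ?N"
    by (intro UN_least image_subsetI)
  with \<open>closed_csubspace ?N\<close> have "ccspan (\<Union>\<alpha>. word_op V \<alpha> ` M) \<subseteq> ?N"
    by (rule ccspan_minimal)
  then have "word_sum V M \<subseteq> ?N" by (simp only: word_sum_def)
  then show "V j ` word_sum V M \<subseteq> word_sum V M"
    by (intro image_subsetI) (drule subsetD, assumption, simp)
qed

lemma row_isometry_word_sum:
  assumes "closed_csubspace L" "row_isometry L V" "M \<subseteq> L"
  shows "row_isometry (word_sum V M) V"
  using invariant_word_sum[OF assms]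
  by (intro row_isometry_subset[OF assms(2) word_sum_subset[OF assms]]) (simp add: invariant_def)

lemma row_shift_word_sum:
  assumes "closed_csubspace L" "row_isometry L V" "wandering L V M"
  shows "row_shift (word_sum V M) V"
  unfolding row_shift_def
  by (intro conjI exI[of _ M] refl row_isometry_word_sum[OF assms(1,2)] wanderingD(2)[OF assms(3)]
      wandering_subset[OF assms(3)] subset_word_sum)

text \<open>If \<open>x\<close> in the sum is orthogonal to every \<open>V j ` word_sum V M\<close>, so is its component
  orthogonal to \<open>M\<close>; this component is then orthogonal to all of the sum, hence zero.\<close>

lemma wandering_part_word_sum:
  assumes L: "closed_csubspace L" "row_isometry L V" and M: "wandering L V M"
  shows "wandering_part (word_sum V M) V = M"
proof
  let ?G = "word_sum V M"
  note M' = wanderingD(1,2)[OF M]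
  have orth: "cinner (V j y) x = 0" if x: "x \<in> M" and y: "y \<in> ?G" for x y j
  proof -
    let ?N = "{y \<in> L. V j y \<in> UNIV \<ominus> {x}}"
    have "word_op V \<alpha> z \<in> ?N" if z: "z \<in> M" for \<alpha> z
    proof -
      have "cinner (word_op V [] x) (word_op V (j # \<alpha>) z) = 0"
        by (rule wanderingD(3)[OF M _ x z]) simp
      then show ?thesis
        using subsetD[OF word_sum_subset[OF L M'(2)] word_op_in_word_sum[OF z, of V \<alpha>]]
        by (simp add: orth_minus_def)
    qed
    then have "(\<Union>\<alpha>. word_op V \<alpha> ` M) \<subseteq> ?N"
      by (intro UN_least image_subsetI)
    moreover have "closed_csubspace ?N"
      using row_isometryD(1)[OF L(2)] L(1)
        closed_csubspace_orth_minus[OF closed_csubspace_UNIV]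
      by (rule closed_csubspace_preimage)
    ultimately have "?G \<subseteq> ?N"
      unfolding word_sum_def by (rule ccspan_minimal[rotated])
    then show ?thesis
      using y by (auto simp: orth_minus_def cinner_eq_zero_commute)
  qed
  show "M \<subseteq> wandering_part ?G V"
    using orth subset_word_sum[of M V] by (auto simp: wandering_part_eq)
  show "wandering_part ?G V \<subseteq> M"
  proof
    fix x assume x: "x \<in> wandering_part ?G V"
    obtain p where p: "p \<in> M" "\<And>z. z \<in> M \<Longrightarrow> cinner z (x - p) = 0"
      using orthogonal_projection_exists[OF M'(1)] by blast
    have xp: "x - p \<in> ?G"
      using x p(1) subset_word_sum[of M V]
      by (auto simp: wandering_part_eq intro: csubspace_diff[OF closed_csubspaceD(1)[OF closed_csubspace_word_sum]])
    have "cinner (word_op V \<alpha> z) (x - p) = 0" if z: "z \<in> M" for \<alpha> z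
    proof (cases \<alpha>)
      case Nil
      then show ?thesis using p(2)[OF z] by simp
    next
      case (Cons j \<beta>)
      have "word_op V \<beta> z \<in> ?G" by (rule word_op_in_word_sum[OF z])
      then show ?thesis
        using orth[OF p(1)] x by (simp add: Cons wandering_part_eq cinner_diff_right)
    qed
    then have "x - p \<in> UNIV \<ominus> (\<Union>\<alpha>. word_op V \<alpha> ` M)"
      by (auto simp: orth_minus_def)
    then have "x - p \<in> UNIV \<ominus> ?G"
      by (simp add: word_sum_def orth_minus_ccspan)
    then have "cinner (x - p) (x - p) = 0"
      using xp unfolding orth_minus_def by blast
    then show "x \<in> M" using p(1) by simp
  qed
qed

text \<open>Every wandering subspace of a row isometry thus supplies an outgoing space; the incoming
  data are forced by the row isometry itself.\<close>

theorem outgoing_Cuntz_scattering_system_wandering: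
  assumes L: "closed_csubspace L" "row_isometry L V" and M: "wandering L V M"
  shows "outgoing_Cuntz_scattering_system V L (word_sum V (wandering_part L V)) (word_sum V M)"
proof -
  note W = wandering_wandering_part[OF L]
  note W' = wanderingD(2)[OF W] and M' = wanderingD(2)[OF M]
  have least: "word_sum V (wandering_part L V) \<subseteq> N"
    if "invariant V N \<and> N \<subseteq> L \<and> wandering_part L V \<subseteq> N" for N
    using that by (intro word_sum_minimal) auto
  show ?thesis
    unfolding outgoing_Cuntz_scattering_system_def
    by (intro conjI allI impI L closed_csubspace_word_sum word_sum_subset[OF L] W' M'
        invariant_word_sum[OF L] subset_word_sum row_shift_word_sum[OF L] W M)
      (fact least)
qed


section \<open>Square-summable families\<close>

lemma ell2_nth_single: "ell2_nth (ell2_single i x) k = (if k = i then x else 0)"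
  by (simp add: ell2_single.rep_eq)

lemma ell2_nth_create_Nil [simp]: "ell2_nth (ell2_create j f) [] = 0"
  and ell2_nth_create_Cons [simp]:
    "ell2_nth (ell2_create j f) (i # v) = (if i = j then ell2_nth f v else 0)"
  by (simp_all add: ell2_create.rep_eq)

lemmas ell2_nth_simps [simp] =
  zero_ell2.rep_eq plus_ell2.rep_eq minus_ell2.rep_eq scaleC_ell2.rep_eq ell2_restrict.rep_eq

lemma ell2_nth_sum: "ell2_nth (\<Sum>i\<in>I. f i) k = (\<Sum>i\<in>I. ell2_nth (f i) k)"
  by (induction I rule: infinite_finite_induct) auto

lemma ell2_single_zero [simp]: "ell2_single i 0 = 0"
  by (rule ell2_eqI) (simp add: ell2_nth_single)

lemma ell2_restrict_zero [simp]: "ell2_restrict A 0 = 0"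
  by (rule ell2_eqI) simp

lemma ell2_create_zero [simp]: "ell2_create j 0 = 0"
  by (rule ell2_eqI) (auto simp: ell2_create.rep_eq split: list.splits)

lemma ell2_create_single: "ell2_create j (ell2_single w x) = ell2_single (j # w) x"
  by (rule ell2_eqI) (auto simp: ell2_create.rep_eq ell2_nth_single split: list.splits)

lemma bounded_clinear_on_ell2_nth: "bounded_clinear_on UNIV UNIV (\<lambda>f. ell2_nth f i)"
  by (rule bounded_clinear_onI[of _ _ _ 1]) (auto simp: norm_ell2_nth_le)

lemma cinner_single_left: "cinner (ell2_single i x) f = cinner x (ell2_nth f i)"
proof -
  have "cinner (ell2_single i x) f = (\<Sum>\<^sub>\<infinity>k\<in>{i}. cinner x (ell2_nth f i))"
    unfolding cinner_ell2.rep_eq by (rule infsum_cong_neutral) (auto simp: ell2_nth_single)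
  then show ?thesis by simp
qed

lemma cinner_create_left:
  "cinner (ell2_create j f) g = (\<Sum>\<^sub>\<infinity>v. cinner (ell2_nth f v) (ell2_nth g (j # v)))"
proof -
  have "cinner (ell2_create j f) g
      = (\<Sum>\<^sub>\<infinity>w\<in>range ((#) j). cinner (ell2_nth (ell2_create j f) w) (ell2_nth g w))"
    unfolding cinner_ell2.rep_eq
    by (rule infsum_cong_neutral) (auto simp: ell2_create.rep_eq split: list.splits)
  also have "\<dots> = (\<Sum>\<^sub>\<infinity>v. cinner (ell2_nth f v) (ell2_nth g (j # v)))"
    by (subst infsum_reindex) (auto simp: o_def)
  finally show ?thesis .
qed

lemma cinner_create: "cinner (ell2_create j f) (ell2_create i g) = (if i = j then cinner f g else 0)"
  unfolding cinner_create_left by (simp add: cinner_ell2.rep_eq)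

lemma cinner_create_single_Nil [simp]: "cinner (ell2_create j f) (ell2_single [] x) = 0"
  "cinner (ell2_single [] x) (ell2_create j f) = 0"
  by (simp_all add: cinner_create_left cinner_single_left ell2_nth_single)

lemma closed_csubspace_fock_tensor:
  assumes "closed_csubspace D"
  shows "closed_csubspace (fock_tensor D)"
proof -
  have "fock_tensor D = (\<Inter>\<alpha>. {f \<in> UNIV. ell2_nth f \<alpha> \<in> D})"
    by (auto simp: fock_tensor_def)
  also have "closed_csubspace \<dots>"
    using closed_csubspace_preimage[OF bounded_clinear_on_ell2_nth closed_csubspace_UNIV assms]
    by (intro closed_csubspace_Inter) auto
  finally show ?thesis .
qed

lemma fock_tensor_single: "csubspace D \<Longrightarrow> x \<in> D \<Longrightarrow> ell2_single w x \<in> fock_tensor D"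
  by (auto simp: fock_tensor_def ell2_nth_single csubspace_0)

lemma fock_tensor_create: "csubspace D \<Longrightarrow> f \<in> fock_tensor D \<Longrightarrow> ell2_create j f \<in> fock_tensor D"
  by (auto simp: fock_tensor_def ell2_create.rep_eq csubspace_0 split: list.splits)


section \<open>Coisometric tuples: defect space and isometric dilation\<close>

text \<open>The defining description of \<^const>\<open>positive_sqrt_on\<close> determines the root of a projection to be
  the projection itself: a positive \<open>S\<close> with \<open>S\<^sup>2 = P\<close> is symmetric, so it vanishes on the kernel
  of \<open>P\<close>, and on the range of \<open>P\<close> the vector \<open>y = S u - u\<close> satisfies \<open>S y = - y\<close>, which positivity
  permits only for \<open>y = 0\<close>.\<close>

lemma positive_sqrt_on_projection:
  assumes K: "csubspace K" and P: "bounded_clinear_on K K P"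
    and idem: "\<And>x. x \<in> K \<Longrightarrow> P (P x) = P x"
    and sym: "\<And>x y. x \<in> K \<Longrightarrow> y \<in> K \<Longrightarrow> cinner x (P y) = cinner (P x) y"
    and x: "x \<in> K"
  shows "positive_sqrt_on K P x = P x"
proof -
  note P_in = bounded_clinear_onD(1)[OF P]
  have "positive_sqrt_on K P = (\<lambda>x. if x \<in> K then P x else 0)"
    unfolding positive_sqrt_on_def
  proof (rule the_equality)
    have "cinner x (P x) \<in> \<real>\<^sub>\<ge>\<^sub>0" if "x \<in> K" for x
      using sym[OF that P_in[OF that]] by (simp add: idem[OF that] cinner_self)
    moreover have "bounded_clinear_on K K (\<lambda>x. if x \<in> K then P x else 0)"
      using P csubspace_add[OF K] csubspace_scaleC[OF K] unfolding bounded_clinear_on_def by auto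
    ultimately show "bounded_clinear_on K K (\<lambda>x. if x \<in> K then P x else 0) \<and>
        (\<forall>x\<in>K. cinner x (if x \<in> K then P x else 0) \<in> \<real>\<^sub>\<ge>\<^sub>0) \<and>
        (\<forall>x\<in>K. (if (if x \<in> K then P x else 0) \<in> K then P (if x \<in> K then P x else 0) else 0) = P x) \<and>
        (\<forall>x. x \<notin> K \<longrightarrow> (if x \<in> K then P x else 0) = 0)"
      using P_in idem by auto
  next
    fix S
    assume "bounded_clinear_on K K S \<and> (\<forall>x\<in>K. cinner x (S x) \<in> \<real>\<^sub>\<ge>\<^sub>0) \<and>
      (\<forall>x\<in>K. S (S x) = P x) \<and> (\<forall>x. x \<notin> K \<longrightarrow> S x = 0)"
    then have S: "bounded_clinear_on K K S" and pos: "\<And>x. x \<in> K \<Longrightarrow> cinner x (S x) \<in> \<real>\<^sub>\<ge>\<^sub>0"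
      and SS: "\<And>x. x \<in> K \<Longrightarrow> S (S x) = P x" and off: "\<And>x. x \<notin> K \<Longrightarrow> S x = 0"
      by auto
    note S_in = bounded_clinear_onD(1)[OF S]
    have real: "Im (cinner x (S x)) = 0" if "x \<in> K" for x
      using pos[OF that] by (auto simp: complex_nonneg_Reals_iff)
    have S_sym: "cinner x (S y) = cinner (S x) y" if "x \<in> K" "y \<in> K" for x y
    proof -
      have iy: "\<i> *\<^sub>C y \<in> K" using that K by (intro csubspace_scaleC)
      have "Im (cinner x (S y)) = - Im (cinner y (S x))"
        using real[OF csubspace_add[OF K that]] real[OF that(1)] real[OF that(2)]
        by (simp add: bounded_clinear_onD(2)[OF S that] cinner_add_left cinner_add_right)
      moreover have "Re (cinner x (S y)) = Re (cinner y (S x))"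
        using real[OF csubspace_add[OF K that(1) iy]] real[OF that(1)] real[OF that(2)]
        by (simp add: bounded_clinear_onD(2)[OF S that(1) iy] bounded_clinear_onD(3)[OF S that(2)]
            cinner_add_left cinner_add_right cinner_scaleC_left cinner_scaleC_right)
      ultimately have "cinner x (S y) = cnj (cinner y (S x))"
        by (simp add: complex_eq_iff)
      also have "\<dots> = cinner (S x) y" by (rule cinner_commute[symmetric])
      finally show ?thesis .
    qed
    show "S = (\<lambda>x. if x \<in> K then P x else 0)"
    proof
      fix x
      show "S x = (if x \<in> K then P x else 0)"
      proof (cases "x \<in> K")
        case True
        have Px: "P x \<in> K" by (rule P_in[OF True])
        have xPx: "x - P x \<in> K" by (rule csubspace_diff[OF K True Px])
        have "cinner (S (x - P x)) (S (x - P x)) = cinner (x - P x) (P (x - P x))"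
          using S_sym[OF xPx S_in[OF xPx]] by (simp add: SS[OF xPx])
        also have "P (x - P x) = 0"
          by (simp add: bounded_clinear_on_diff[OF P K True Px] idem[OF True])
        finally have ker: "S x = S (P x)"
          by (simp add: bounded_clinear_on_diff[OF S K True Px])
        define y where "y = S (P x) - P x"
        have y: "y \<in> K" unfolding y_def by (intro csubspace_diff[OF K] S_in Px)
        have "S y = - y"
          by (simp add: y_def bounded_clinear_on_diff[OF S K S_in[OF Px] Px] SS[OF Px] idem[OF True])
        then have "cinner y (S y) = - cinner y y"
          using cinner_diff_right[of y 0 y] by simp
        then have "y = 0"
          using pos[OF y] by (auto simp: complex_nonneg_Reals_iff cinner_self)
        with ker True show ?thesis by (simp add: y_def)
      qed (simp add: off)
    qed
  qed
  with x show ?thesis by simp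
qed

lemma closed_csubspace_direct_sum:
  assumes "closed_csubspace H"
  shows "closed_csubspace (direct_sum H :: ('a::complex_hilbert ^ 'd::finite) set)"
proof -
  have "bounded_clinear_on UNIV UNIV (\<lambda>v :: 'a ^ 'd. v $ j)" for j
    by (rule bounded_clinear_onI[of _ _ _ 1]) (auto simp: scaleC_vec_def Finite_Cartesian_Product.norm_nth_le)
  then have "closed_csubspace {v \<in> UNIV. (v :: 'a ^ 'd) $ j \<in> H}" for j
    by (rule closed_csubspace_preimage) (auto simp: closed_csubspace_UNIV assms)
  moreover have "(direct_sum H :: ('a ^ 'd) set) = (\<Inter>j. {v \<in> UNIV. v $ j \<in> H})"
    by (auto simp: direct_sum_def)
  ultimately show ?thesis
    by (auto intro: closed_csubspace_Inter)
qed

lemma direct_sum_nth: "v \<in> direct_sum H \<Longrightarrow> v $ j \<in> H"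
  by (simp add: direct_sum_def)

lemma axis_in_direct_sum: "csubspace H \<Longrightarrow> x \<in> H \<Longrightarrow> axis j x \<in> direct_sum H"
  by (auto simp: direct_sum_def axis_def csubspace_0)

lemma norm_eq_of_cinner: "cinner x x = cinner y y \<Longrightarrow> norm x = norm y"
  for x :: "'a::complex_hilbert" and y :: "'b::complex_hilbert"
  by (simp add: cinner_self flip: of_real_power)

text \<open>If \<open>T\<close> is coisometric, \<open>T\<^sup>* T\<close> is the projection onto the orthogonal complement of the kernel
  of the row operator. So the defect operator \<open>(I - T\<^sup>* T)\<^sup>1\<^sup>/\<^sup>2\<close> is the projection \<open>kernel_proj\<close> onto
  that kernel, and the defect space is the kernel itself.\<close>

locale coisometric_tuple =
  fixes H :: "'a::complex_hilbert set" and T :: "'d::finite \<Rightarrow> 'a \<Rightarrow> 'a"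
  assumes closed_H: "closed_csubspace H" and coisometric: "coisometric H T"
begin

lemma T_bounded: "bounded_clinear_on H H (T j)"
  using coisometric by (simp add: coisometric_def)

lemmas csubspace_H = closed_csubspaceD(1)[OF closed_H]
lemmas closed_sum = closed_csubspace_direct_sum[OF closed_H, where 'd = 'd]
lemmas csubspace_sum_H = closed_csubspaceD(1)[OF closed_sum]
lemmas axis_in_sum = axis_in_direct_sum[OF csubspace_H, where 'b = 'd]

definition row_adjoint :: "'a \<Rightarrow> 'a ^ 'd"
  where "row_adjoint h = (\<chi> j. adjoint_on H (T j) h)"

lemma row_adjoint_in: "row_adjoint h \<in> direct_sum H"
  using adjoint_on(1)[OF closed_H T_bounded] by (simp add: direct_sum_def row_adjoint_def)

lemma row_op_in: "v \<in> direct_sum H \<Longrightarrow> row_op T v \<in> H"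
  unfolding row_op_def
  by (intro csubspace_sum[OF csubspace_H] bounded_clinear_onD(1)[OF T_bounded] direct_sum_nth)

lemma cinner_row_op:
  assumes "v \<in> direct_sum H"
  shows "cinner (row_op T v) h = cinner v (row_adjoint h)"
  unfolding row_op_def cinner_sum_left cinner_vec_def
  using adjoint_on(2)[OF closed_H T_bounded direct_sum_nth[OF assms]]
  by (simp add: row_adjoint_def)

lemma row_op_row_adjoint: "h \<in> H \<Longrightarrow> row_op T (row_adjoint h) = h"
  using coisometric by (simp add: coisometric_def row_op_def row_adjoint_def)

lemma row_op_axis: "row_op T (axis j x) = T j x"
proof -
  have "row_op T (axis j x) = (\<Sum>i\<in>UNIV. if i = j then T j x else 0)"
    unfolding row_op_def
    by (rule sum.cong) (auto simp: axis_def bounded_clinear_on_zero[OF T_bounded csubspace_H])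
  then show ?thesis by simp
qed

lemma row_op_bounded: "bounded_clinear_on (direct_sum H) H (row_op T)"
proof -
  have "\<exists>K. \<forall>x\<in>H. norm (T j x) \<le> K * norm x" for j
    using T_bounded[of j] by (simp add: bounded_clinear_on_def)
  then obtain K where K: "\<And>j x. x \<in> H \<Longrightarrow> norm (T j x) \<le> K j * norm x" by metis
  show ?thesis
  proof (rule bounded_clinear_onI[of _ _ _ "\<Sum>j\<in>UNIV. \<bar>K j\<bar>"])
    fix v :: "'a ^ 'd" assume v: "v \<in> direct_sum H"
    have "norm (T j (v $ j)) \<le> \<bar>K j\<bar> * norm v" for j
    proof -
      have "norm (T j (v $ j)) \<le> K j * norm (v $ j)" by (rule K[OF direct_sum_nth[OF v]])
      also have "\<dots> \<le> \<bar>K j\<bar> * norm v"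
        by (intro mult_mono) (auto simp: Finite_Cartesian_Product.norm_nth_le)
      finally show ?thesis .
    qed
    then show "norm (row_op T v) \<le> (\<Sum>j\<in>UNIV. \<bar>K j\<bar>) * norm v"
      unfolding row_op_def sum_distrib_right by (intro sum_norm_le) auto
  next
    fix v :: "'a ^ 'd" assume "v \<in> direct_sum H"
    then show "row_op T v \<in> H" by (rule row_op_in)
  next
    fix v w :: "'a ^ 'd" assume "v \<in> direct_sum H" "w \<in> direct_sum H"
    then show "row_op T (v + w) = row_op T v + row_op T w"
      by (simp add: row_op_def bounded_clinear_onD(2)[OF T_bounded] direct_sum_nth sum.distrib)
  next
    fix c and v :: "'a ^ 'd" assume v: "v \<in> direct_sum H"
    have "row_op T (c *\<^sub>C v) = (\<Sum>j\<in>UNIV. c *\<^sub>C T j (v $ j))"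
      by (simp add: row_op_def scaleC_vec_def bounded_clinear_onD(3)[OF T_bounded] direct_sum_nth v)
    also have "\<dots> = c *\<^sub>C row_op T v"
      by (simp add: row_op_def scaleC_sum_right)
    finally show "row_op T (c *\<^sub>C v) = c *\<^sub>C row_op T v" .
  qed
qed

lemma row_adjoint_0: "row_adjoint 0 = 0"
  unfolding row_adjoint_def
  by (simp add: vec_eq_iff adjoint_on_eqI[OF csubspace_H csubspace_0[OF csubspace_H]])

definition kernel_proj :: "'a ^ 'd \<Rightarrow> 'a ^ 'd"
  where "kernel_proj v = v - row_adjoint (row_op T v)"

lemma kernel_proj_in: "v \<in> direct_sum H \<Longrightarrow> kernel_proj v \<in> direct_sum H"
  unfolding kernel_proj_def by (intro csubspace_diff[OF csubspace_sum_H] row_adjoint_in)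

lemma row_op_kernel_proj: "v \<in> direct_sum H \<Longrightarrow> row_op T (kernel_proj v) = 0"
  unfolding kernel_proj_def
  by (simp add: bounded_clinear_on_diff[OF row_op_bounded csubspace_sum_H] row_adjoint_in
      row_op_row_adjoint row_op_in)

lemma kernel_proj_id: "row_op T v = 0 \<Longrightarrow> kernel_proj v = v"
  by (simp add: kernel_proj_def row_adjoint_0)

lemma cinner_kernel_proj_right:
  assumes "v \<in> direct_sum H"
  shows "cinner v (kernel_proj w) = cinner v w - cinner (row_op T v) (row_op T w)"
  by (simp add: kernel_proj_def cinner_diff_right cinner_row_op[OF assms])

lemma cinner_kernel_proj_left:
  assumes "w \<in> direct_sum H"
  shows "cinner (kernel_proj v) w = cinner v w - cinner (row_op T v) (row_op T w)"
  using cinner_kernel_proj_right[OF assms, of v]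
  by (metis cinner_commute complex_cnj_diff)

lemma kernel_proj_bounded: "bounded_clinear_on (direct_sum H) (direct_sum H) kernel_proj"
proof (rule bounded_clinear_onI[of _ _ _ 1])
  note add = csubspace_add[OF csubspace_sum_H] and scaleC = csubspace_scaleC[OF csubspace_sum_H]
  fix v :: "'a ^ 'd" assume v: "v \<in> direct_sum H"
  then show "kernel_proj v \<in> direct_sum H" by (rule kernel_proj_in)
  have "cinner (kernel_proj v) (kernel_proj v) = cinner (kernel_proj v) v"
    by (simp add: cinner_kernel_proj_right kernel_proj_in v row_op_kernel_proj)
  then have "(norm (kernel_proj v))\<^sup>2 = inner (kernel_proj v) v"
    by (metis Re_cinner power2_norm_eq_inner)
  also have "\<dots> \<le> norm (kernel_proj v) * norm v" by (rule norm_cauchy_schwarz)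
  finally show "norm (kernel_proj v) \<le> 1 * norm v"
    by (cases "norm (kernel_proj v) = 0") (auto simp: power2_eq_square)
  show "kernel_proj (c *\<^sub>C v) = c *\<^sub>C kernel_proj v" for c
    by (rule orthogonal_self[OF csubspace_sum_H])
      (simp_all add: v scaleC kernel_proj_in cinner_diff_right cinner_kernel_proj_right
        cinner_scaleC_right bounded_clinear_onD(3)[OF row_op_bounded] algebra_simps)
  fix w :: "'a ^ 'd" assume w: "w \<in> direct_sum H"
  show "kernel_proj (v + w) = kernel_proj v + kernel_proj w"
    by (rule orthogonal_self[OF csubspace_sum_H])
      (simp_all add: v w add kernel_proj_in cinner_diff_right cinner_kernel_proj_right
        cinner_add_right bounded_clinear_onD(2)[OF row_op_bounded])
qed

lemma defect_op_eq: "v \<in> direct_sum H \<Longrightarrow> defect_op H T v = kernel_proj v"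
proof -
  assume v: "v \<in> direct_sum H"
  have "adjoint_on (direct_sum H) (row_op T) h = row_adjoint h" for h
    by (intro adjoint_on_eqI csubspace_sum_H row_adjoint_in cinner_row_op)
  then have "defect_op H T v = positive_sqrt_on (direct_sum H) kernel_proj v"
    by (simp add: defect_op_def kernel_proj_def[abs_def])
  also have "\<dots> = kernel_proj v"
  proof (rule positive_sqrt_on_projection[OF csubspace_sum_H kernel_proj_bounded _ _ v])
    fix x y :: "'a ^ 'd" assume "x \<in> direct_sum H" "y \<in> direct_sum H"
    then show "cinner x (kernel_proj y) = cinner (kernel_proj x) y"
      by (simp add: cinner_kernel_proj_left cinner_kernel_proj_right)
  qed (intro kernel_proj_id row_op_kernel_proj)
  finally show ?thesis .
qed

lemma defect_space_eq: "defect_space H T = {v \<in> direct_sum H. row_op T v = 0}" (is "_ = ?D")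
proof -
  have "defect_op H T ` direct_sum H = ?D"
  proof (intro equalityI subsetI)
    fix v assume v: "v \<in> ?D"
    then have "v = defect_op H T v" by (simp add: defect_op_eq kernel_proj_id)
    with v show "v \<in> defect_op H T ` direct_sum H" by blast
  qed (auto simp: defect_op_eq kernel_proj_in row_op_kernel_proj)
  moreover have "closed {v \<in> direct_sum H. row_op T v \<in> {0}}"
    by (rule closed_csubspaceD(2)[OF closed_csubspace_preimage[OF row_op_bounded closed_sum
            closed_csubspace_singleton]])
  ultimately show ?thesis by (simp add: defect_space_def)
qed

lemma closed_csubspace_defect_space: "closed_csubspace (defect_space H T)"
  using closed_csubspace_preimage[OF row_op_bounded closed_sum closed_csubspace_singleton]
  by (simp add: defect_space_eq)

lemmas csubspace_defect_space = closed_csubspaceD(1)[OF closed_csubspace_defect_space]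

lemma defect_op_in: "v \<in> direct_sum H \<Longrightarrow> defect_op H T v \<in> defect_space H T"
  by (simp add: defect_space_eq defect_op_eq kernel_proj_in row_op_kernel_proj)

text \<open>The map \<open>v \<mapsto> (row_op T v, defect_op H T v)\<close> is a unitary from \<open>direct_sum H\<close> onto
  \<open>H \<times> defect_space H T\<close>, with inverse \<open>(h, y) \<mapsto> row_adjoint h + y\<close>. Both the dilation and the
  stage unitaries are this map in coordinates.\<close>

lemma row_adjoint_plus_defect: "v \<in> direct_sum H \<Longrightarrow> row_adjoint (row_op T v) + defect_op H T v = v"
  by (simp add: defect_op_eq kernel_proj_def)

lemma cinner_row_op_defect:
  assumes "v \<in> direct_sum H" "w \<in> direct_sum H"
  shows "cinner (row_op T v) (row_op T w) + cinner (defect_op H T v) (defect_op H T w) = cinner v w"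
  using assms by (simp add: defect_op_eq cinner_kernel_proj_right kernel_proj_in
      row_op_kernel_proj cinner_kernel_proj_left)

lemma cinner_row_adjoint_plus:
  assumes "h \<in> H" "h' \<in> H" "y \<in> defect_space H T" "y' \<in> defect_space H T"
  shows "cinner (row_adjoint h + y) (row_adjoint h' + y') = cinner h h' + cinner y y'"
proof -
  have "cinner (row_adjoint h) (row_adjoint h') = cinner h h'"
    using cinner_row_op[OF row_adjoint_in, of h h'] by (simp add: row_op_row_adjoint assms)
  moreover have "cinner y (row_adjoint h') = 0" "cinner y' (row_adjoint h) = 0"
    using assms cinner_row_op[of y h'] cinner_row_op[of y' h] by (auto simp: defect_space_eq)
  ultimately show ?thesis
    by (simp add: cinner_add_left cinner_add_right cinner_eq_zero_commute[of _ y'])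
qed

lemma defect_comp_eq: "l \<in> H \<Longrightarrow> defect_comp H T j l = kernel_proj (axis j l)"
  by (simp add: defect_comp_def defect_op_eq axis_in_sum)

lemma defect_comp_in: "l \<in> H \<Longrightarrow> defect_comp H T j l \<in> defect_space H T"
  by (simp add: defect_comp_def defect_op_in axis_in_sum)

lemma cinner_defect_comp:
  assumes "a \<in> H" "y \<in> defect_space H T"
  shows "cinner (defect_comp H T j a) y = cinner a (y $ j)"
  using assms by (simp add: defect_comp_eq cinner_kernel_proj_left defect_space_eq cinner_axis_left)

lemma adjoint_defect_comp: "y \<in> defect_space H T \<Longrightarrow> adjoint_on H (defect_comp H T j) y = y $ j"
  by (intro adjoint_on_eqI[OF csubspace_H] cinner_defect_comp)
    (auto simp: defect_space_eq direct_sum_nth)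

lemma cinner_T_defect_comp:
  assumes "a \<in> H" "b \<in> H"
  shows "cinner (T i a) (T j b) + cinner (defect_comp H T i a) (defect_comp H T j b)
    = (if i = j then cinner a b else 0)"
  using cinner_row_op_defect[OF axis_in_sum[OF assms(1)] axis_in_sum[OF assms(2)], of i j]
  by (simp add: row_op_axis defect_comp_def cinner_axis_left) (simp add: axis_def)

lemma dilation_zero: "dilation H T j (0, f) = (0, ell2_create j f)"
proof -
  have axis: "axis j 0 = (0 :: 'a ^ 'd)" by (simp add: vec_eq_iff axis_def)
  have "defect_comp H T j 0 = 0"
    using bounded_clinear_on_zero[OF kernel_proj_bounded csubspace_sum_H]
    by (simp add: defect_comp_eq csubspace_0[OF csubspace_H] axis)
  then show ?thesis
    by (simp add: dilation_def bounded_clinear_on_zero[OF T_bounded csubspace_H])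
qed

lemma dilation_row_isometry:
  "row_isometry (H \<times> fock_tensor (defect_space H T)) (dilation H T)" (is "row_isometry ?L ?V")
proof -
  note D = csubspace_defect_space
  have cinner: "cinner (?V i x) (?V j y) = (if i = j then cinner x y else 0)"
    if x: "x \<in> ?L" and y: "y \<in> ?L" for i j x y
    using x y cinner_T_defect_comp[of "fst x" "fst y" i j]
    by (auto simp: dilation_def cinner_prod_def cinner_add_left cinner_add_right cinner_create
        cinner_single_left[of "[]"] ell2_nth_single algebra_simps split: prod.splits)
  have norm: "norm (?V j x) = norm x" if "x \<in> ?L" for j x
    using cinner[OF that that, of j j] by (intro norm_eq_of_cinner) simp
  have add: "defect_comp H T j (l + m) = defect_comp H T j l + defect_comp H T j m"
    if "l \<in> H" "m \<in> H" for j l m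
  proof -
    have "axis j (l + m) = (axis j l + axis j m :: 'a ^ 'd)" by (simp add: vec_eq_iff axis_def)
    then show ?thesis
      using that bounded_clinear_onD(2)[OF kernel_proj_bounded axis_in_sum axis_in_sum]
      by (simp add: defect_comp_eq csubspace_add[OF csubspace_H])
  qed
  have scaleC: "defect_comp H T j (c *\<^sub>C l) = c *\<^sub>C defect_comp H T j l" if "l \<in> H" for j c l
  proof -
    have "axis j (c *\<^sub>C l) = (c *\<^sub>C axis j l :: 'a ^ 'd)"
      by (simp add: vec_eq_iff axis_def scaleC_vec_def)
    then show ?thesis
      using that bounded_clinear_onD(3)[OF kernel_proj_bounded axis_in_sum]
      by (simp add: defect_comp_eq csubspace_scaleC[OF csubspace_H])
  qed
  have "bounded_clinear_on ?L ?L (?V j)" for j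
  proof (rule bounded_clinear_onI[of _ _ _ 1])
    fix x assume x: "x \<in> ?L"
    then obtain l f where lf: "x = (l, f)" "l \<in> H" "f \<in> fock_tensor (defect_space H T)" by auto
    have "ell2_single [] (defect_comp H T j l) + ell2_create j f \<in> fock_tensor (defect_space H T)"
      using closed_csubspace_fock_tensor[OF closed_csubspace_defect_space] lf
      by (intro csubspace_add fock_tensor_single fock_tensor_create D defect_comp_in closed_csubspaceD)
    with lf show "?V j x \<in> ?L"
      by (simp add: dilation_def bounded_clinear_onD(1)[OF T_bounded])
    show "norm (?V j x) \<le> 1 * norm x" by (simp add: norm[OF x])
    show "?V j (c *\<^sub>C x) = c *\<^sub>C ?V j x" for c
      using lf(2) unfolding lf(1)
      by (auto simp: dilation_def scaleC_prod_def bounded_clinear_onD(3)[OF T_bounded] scaleC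
          ell2_nth_single ell2_create.rep_eq intro!: ell2_eqI split: list.splits)
    fix y assume "y \<in> ?L"
    then obtain m g where mg: "y = (m, g)" "m \<in> H" by auto
    show "?V j (x + y) = ?V j x + ?V j y"
      using lf(2) mg(2) unfolding lf(1) mg(1)
      by (auto simp: dilation_def bounded_clinear_onD(2)[OF T_bounded] add
          ell2_nth_single ell2_create.rep_eq intro!: ell2_eqI split: list.splits)
  qed
  then show ?thesis
    unfolding row_isometry_def using norm cinner by simp
qed

end


section \<open>The stage unitaries\<close>

lemma finite_words: "finite {w :: 'd::finite list. length w = n}"
  using finite_lists_length_eq[of "UNIV :: 'd set" n] by simp

lemma cinner_finite_support:
  assumes "finite F" "\<And>w. w \<notin> F \<Longrightarrow> ell2_nth f w = 0"
  shows "cinner f g = (\<Sum>w\<in>F. cinner (ell2_nth f w) (ell2_nth g w))"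
proof -
  have "cinner f g = (\<Sum>\<^sub>\<infinity>w\<in>F. cinner (ell2_nth f w) (ell2_nth g w))"
    unfolding cinner_ell2.rep_eq by (rule infsum_cong_neutral) (auto simp: assms(2))
  with assms(1) show ?thesis by simp
qed

lemma ell2_nth_append_sum:
  fixes a :: "'d::finite list \<Rightarrow> 'a::complex_hilbert ^ 'd"
  shows "ell2_nth (\<Sum>w | length w = n. \<Sum>j\<in>UNIV. ell2_single (w @ [j]) (a w $ j)) u
    = (if length u = Suc n then a (butlast u) $ last u else 0)"
proof (cases u rule: rev_cases)
  case Nil
  then show ?thesis by (simp add: ell2_nth_sum ell2_nth_single)
next
  case (snoc v k)
  have "(if u = w @ [j] then a w $ j else 0) = (if k = j then if v = w then a w $ j else 0 else 0)" for w j
    by (simp add: snoc)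
  then show ?thesis
    by (simp add: ell2_nth_sum ell2_nth_single snoc finite_words)
qed

lemma cinner_append_sum:
  fixes a b :: "'d::finite list \<Rightarrow> 'a::complex_hilbert ^ 'd"
  shows "cinner (\<Sum>w | length w = n. \<Sum>j\<in>UNIV. ell2_single (w @ [j]) (a w $ j))
      (\<Sum>w | length w = n. \<Sum>j\<in>UNIV. ell2_single (w @ [j]) (b w $ j))
    = (\<Sum>w | length w = n. cinner (a w) (b w))"
  unfolding cinner_sum_left cinner_single_left ell2_nth_append_sum
  by (simp add: cinner_vec_def)

lemma cinner_split_length:
  fixes y y' :: "('d::finite list, 'a::complex_hilbert) ell2"
  assumes "\<And>\<alpha>. length \<alpha> < n \<Longrightarrow> ell2_nth y \<alpha> = 0"
  shows "cinner y y' = (\<Sum>w | length w = n. cinner (ell2_nth y w) (ell2_nth y' w))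
    + cinner (ell2_restrict {\<alpha>. Suc n \<le> length \<alpha>} y) (ell2_restrict {\<alpha>. Suc n \<le> length \<alpha>} y')"
proof -
  let ?R = "ell2_restrict {\<alpha>. Suc n \<le> length \<alpha>}"
  have "cinner (y - ?R y) y' = (\<Sum>w | length w = n. cinner (ell2_nth y w) (ell2_nth y' w))"
    by (subst cinner_finite_support[OF finite_words[of n]]) (auto simp: assms not_less_eq_eq le_less)
  moreover have "cinner (?R y) y' = cinner (?R y) (?R y')"
    unfolding cinner_ell2.rep_eq by (rule infsum_cong) simp
  ultimately show ?thesis
    by (simp add: cinner_diff_left algebra_simps)
qed

context coisometric_tuple
begin

lemma stage_spaceD:
  assumes "(h, y) \<in> stage_space H T n"
  shows "ell2_nth h w \<in> H" and "length w \<noteq> n \<Longrightarrow> ell2_nth h w = 0"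
    and "ell2_nth y w \<in> defect_space H T" and "length w < n \<Longrightarrow> ell2_nth y w = 0"
  using assms by (auto simp: stage_space_def)

lemma csubspace_stage_space: "csubspace (stage_space H T n)"
  using csubspace_H csubspace_defect_space
  by (auto simp: csubspace_def stage_space_def scaleC_prod_def zero_prod_def)

text \<open>On each word the stage unitary applies \<open>(h, y) \<mapsto> row_adjoint h + y\<close> and distributes the
  coordinates of the result over the successors of the word.\<close>

lemma stage_unitary_eq:
  assumes "\<And>w. ell2_nth y w \<in> defect_space H T"
  shows "stage_unitary H T (Suc n) (h, y) =
    (\<Sum>w | length w = n. \<Sum>j\<in>UNIV.
       ell2_single (w @ [j]) ((row_adjoint (ell2_nth h w) + ell2_nth y w) $ j),
     ell2_restrict {\<alpha>. Suc n \<le> length \<alpha>} y)"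
  using assms by (simp add: stage_unitary_def adjoint_defect_comp row_adjoint_def)

lemma stage_unitary_in:
  assumes "x \<in> stage_space H T n"
  shows "stage_unitary H T (Suc n) x \<in> stage_space H T (Suc n)"
proof -
  obtain h y where x: "x = (h, y)" by (cases x)
  note xD = stage_spaceD[OF assms[unfolded x]]
  have "row_adjoint (ell2_nth h w) + ell2_nth y w \<in> direct_sum H" for w
    using xD(3)[of w] by (intro csubspace_add[OF csubspace_sum_H] row_adjoint_in) (simp add: defect_space_eq)
  then show ?thesis
    unfolding x stage_unitary_eq[OF xD(3)]
    using xD(3) csubspace_0[OF csubspace_H] csubspace_0[OF csubspace_defect_space]
    by (auto simp: stage_space_def ell2_nth_append_sum dest: direct_sum_nth simp del: vector_add_component)
qed

lemma stage_unitary_cinner: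
  assumes "x \<in> stage_space H T n" "x' \<in> stage_space H T n"
  shows "cinner (stage_unitary H T (Suc n) x) (stage_unitary H T (Suc n) x') = cinner x x'"
proof -
  obtain h y h' y' where x: "x = (h, y)" "x' = (h', y')" by (cases x, cases x')
  note xD = stage_spaceD[OF assms(1)[unfolded x]] and xD' = stage_spaceD[OF assms(2)[unfolded x]]
  have "cinner h h' = (\<Sum>w | length w = n. cinner (ell2_nth h w) (ell2_nth h' w))"
    by (rule cinner_finite_support[OF finite_words]) (simp add: xD(2))
  moreover have "cinner y y' = (\<Sum>w | length w = n. cinner (ell2_nth y w) (ell2_nth y' w))
    + cinner (ell2_restrict {\<alpha>. Suc n \<le> length \<alpha>} y) (ell2_restrict {\<alpha>. Suc n \<le> length \<alpha>} y')"
    by (rule cinner_split_length) (simp add: xD(4))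
  ultimately show ?thesis
    unfolding x stage_unitary_eq[OF xD(3)] stage_unitary_eq[OF xD'(3)] cinner_prod_def fst_conv snd_conv
      cinner_append_sum
    by (simp add: cinner_row_adjoint_plus xD(1,3) xD'(1,3) sum.distrib)
qed

text \<open>The adjoint of an isometry is a left inverse. Hence going down from stage \<open>Suc n\<close> is computed
  by exhibiting a preimage in stage \<open>n\<close>.\<close>

lemma adjoint_stage_unitary:
  assumes "x \<in> stage_space H T n"
  shows "adjoint_on (stage_space H T n) (stage_unitary H T (Suc n)) (stage_unitary H T (Suc n) x) = x"
  by (intro adjoint_on_eqI csubspace_stage_space assms stage_unitary_cinner)

end


section \<open>Coisometric liftings\<close>

locale lifting = C: coisometric_tuple HC C + E: coisometric_tuple HE E
  for HC HE :: "'a::complex_hilbert set" and C E :: "'d::finite \<Rightarrow> 'a \<Rightarrow> 'a" +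
  assumes is_lifting: "coisometric_lifting HC C HE E"
begin

abbreviation "HA \<equiv> HE \<ominus> HC"

abbreviation "DC \<equiv> defect_space HC C"

abbreviation "DE \<equiv> defect_space HE E"

abbreviation L :: "('a, 'd) dil set"
  where "L \<equiv> HA \<times> fock_tensor DE"

lemma HC_subset: "HC \<subseteq> HE"
  and proj_E: "x \<in> HC \<Longrightarrow> orth_proj HC (E j x) = C j x"
  and E_HA: "x \<in> HA \<Longrightarrow> E j x \<in> HA"
  using is_lifting by (auto simp: coisometric_lifting_def)

lemma HA_D: "x \<in> HA \<Longrightarrow> x \<in> HE" "x \<in> HA \<Longrightarrow> z \<in> HC \<Longrightarrow> cinner z x = 0"
  "x \<in> HA \<Longrightarrow> z \<in> HC \<Longrightarrow> cinner x z = 0"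
  by (auto simp: orth_minus_def cinner_eq_zero_commute)

lemma HC_I: "x \<in> HE \<Longrightarrow> (\<And>a. a \<in> HA \<Longrightarrow> cinner a x = 0) \<Longrightarrow> x \<in> HC"
  using orth_minus_orth_minus[OF E.csubspace_H C.closed_H HC_subset] by (auto simp: orth_minus_def)

lemma direct_sum_subset: "v \<in> direct_sum HC \<Longrightarrow> v \<in> direct_sum HE"
  using HC_subset by (auto simp: direct_sum_def)

text \<open>The compression of \<open>E\<^sub>j\<close> to \<open>HC\<close> is \<open>C\<^sub>j\<close>, so vectors of \<open>HC\<close> cannot distinguish the two row
  operators on \<open>direct_sum HC\<close>.\<close>

lemma cinner_row_op_lift:
  assumes "z \<in> HC" "v \<in> direct_sum HC"
  shows "cinner z (row_op E v) = cinner z (row_op C v)"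
  unfolding row_op_def cinner_sum_right
  using cinner_orth_proj[OF C.closed_H assms(1)] proj_E[OF direct_sum_nth[OF assms(2)]]
  by (metis (no_types, lifting))

text \<open>In the adjoint block form the triangle is upper, so \<open>E\<^sub>j\<^sup>*\<close> leaves \<open>HC\<close> invariant and acts
  there as \<open>C\<^sub>j\<^sup>*\<close>.\<close>

lemma row_adjoint_lift:
  assumes h: "h \<in> HC"
  shows "C.row_adjoint h = E.row_adjoint h"
proof -
  have "E.row_adjoint h $ j \<in> HC" for j
  proof (rule HC_I)
    show "E.row_adjoint h $ j \<in> HE" by (rule direct_sum_nth[OF E.row_adjoint_in])
    fix a assume a: "a \<in> HA"
    have "cinner a (E.row_adjoint h $ j) = cinner (E j a) h"
      using E.cinner_row_op[OF E.axis_in_sum[OF HA_D(1)[OF a]], of j h]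
      by (simp add: E.row_op_axis cinner_axis_left)
    then show "cinner a (E.row_adjoint h $ j) = 0"
      using HA_D(3)[OF E_HA[OF a] h] by simp
  qed
  then have in_sum: "E.row_adjoint h \<in> direct_sum HC" by (simp add: direct_sum_def)
  show ?thesis
  proof (rule orthogonal_self[OF C.csubspace_sum_H C.row_adjoint_in in_sum])
    fix v :: "'a ^ 'd" assume v: "v \<in> direct_sum HC"
    have "cinner (row_op C v) h = cinner (row_op E v) h"
      using cinner_row_op_lift[OF h v] by (metis cinner_commute)
    then show "cinner v (C.row_adjoint h - E.row_adjoint h) = 0"
      by (simp add: cinner_diff_right C.cinner_row_op[OF v, symmetric]
          E.cinner_row_op[OF direct_sum_subset[OF v], symmetric])
  qed
qed

lemma stage_unitary_lift:
  assumes "(h, 0) \<in> stage_space HC C n"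
  shows "stage_unitary HC C (Suc n) (h, 0) = stage_unitary HE E (Suc n) (h, 0)"
proof -
  note hD = C.stage_spaceD[OF assms]
  have "ell2_nth 0 w \<in> DE" for w
    using csubspace_0[OF E.csubspace_defect_space] by simp
  then show ?thesis
    unfolding C.stage_unitary_eq[OF hD(3)] by (simp add: E.stage_unitary_eq row_adjoint_lift hD(1))
qed

text \<open>After one step the vector \<open>e\<^sub>\<emptyset> \<otimes> d\<close> has become \<open>\<Sum>\<^sub>j d\<^sub>j \<otimes> \<epsilon>\<^sub>j\<close>, whose second component is
  zero. On such vectors the unitaries of \<open>C\<close> and \<open>E\<close> agree, so every further step up is undone by
  the step down. The remaining step down is the inverse of \<open>(h, y) \<mapsto> E.row_adjoint h + y\<close>,
  evaluated at \<open>d\<close>.\<close>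

lemma stage_down_stage_up:
  assumes d: "d \<in> DC"
  shows "\<exists>h. stage_up HC C (Suc n) (0, ell2_single [] d) = (h, 0) \<and> (h, 0) \<in> stage_space HC C (Suc n) \<and>
    stage_down HE E (Suc n) (h, 0) = (row_op E d, ell2_single [] (defect_op HE E d))"
proof (induction n)
  case 0
  have dC: "d \<in> direct_sum HC" using d by (simp add: C.defect_space_eq)
  note dE = direct_sum_subset[OF dC]
  have start: "(0, ell2_single [] d) \<in> stage_space HC C 0"
    using d csubspace_0[OF C.csubspace_H] csubspace_0[OF C.csubspace_defect_space]
    by (auto simp: stage_space_def ell2_nth_single)
  have start': "(ell2_single [] (row_op E d), ell2_single [] (defect_op HE E d)) \<in> stage_space HE E 0"
    using E.row_op_in[OF dE] E.defect_op_in[OF dE] csubspace_0[OF E.csubspace_H]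
      csubspace_0[OF E.csubspace_defect_space]
    by (auto simp: stage_space_def ell2_nth_single)
  have restrict: "ell2_restrict {\<alpha>. Suc 0 \<le> length \<alpha>} (ell2_single [] z) = 0"
    for z :: "'a ^ 'd"
    by (rule ell2_eqI) (simp add: ell2_nth_single)
  let ?k = "\<Sum>j\<in>UNIV. ell2_single [j] (d $ j)"
  have up: "stage_unitary HC C (Suc 0) (0, ell2_single [] d) = (?k, 0)"
    unfolding C.stage_unitary_eq[OF C.stage_spaceD(3)[OF start]]
    by (simp add: restrict ell2_nth_single C.row_adjoint_0)
  have "stage_unitary HE E (Suc 0) (ell2_single [] (row_op E d), ell2_single [] (defect_op HE E d)) = (?k, 0)"
    unfolding E.stage_unitary_eq[OF E.stage_spaceD(3)[OF start']]
    by (simp add: restrict ell2_nth_single E.row_adjoint_plus_defect[OF dE] del: vector_add_component)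
  then have "adjoint_on (stage_space HE E 0) (stage_unitary HE E (Suc 0)) (?k, 0)
      = (ell2_single [] (row_op E d), ell2_single [] (defect_op HE E d))"
    using E.adjoint_stage_unitary[OF start'] by simp
  then show ?case
    using up C.stage_unitary_in[OF start] by (intro exI[of _ ?k]) (simp add: ell2_nth_single)
next
  case (Suc n)
  then obtain h where h: "stage_up HC C (Suc n) (0, ell2_single [] d) = (h, 0)"
      "(h, 0) \<in> stage_space HC C (Suc n)"
      "stage_down HE E (Suc n) (h, 0) = (row_op E d, ell2_single [] (defect_op HE E d))"
    by blast
  have hE: "(h, 0) \<in> stage_space HE E (Suc n)"
    using h(2) HC_subset csubspace_0[OF E.csubspace_defect_space] by (auto simp: stage_space_def)
  obtain k where k: "stage_unitary HC C (Suc (Suc n)) (h, 0) = (k, 0)"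
  proof
    show "stage_unitary HC C (Suc (Suc n)) (h, 0)
        = (fst (stage_unitary HC C (Suc (Suc n)) (h, 0)), 0)"
      by (simp add: stage_unitary_def)
  qed
  have "adjoint_on (stage_space HE E (Suc n)) (stage_unitary HE E (Suc (Suc n))) (k, 0) = (h, 0)"
    using E.adjoint_stage_unitary[OF hE] by (simp flip: k add: stage_unitary_lift[OF h(2)])
  then have "stage_down HE E (Suc (Suc n)) (k, 0) = stage_down HE E (Suc n) (h, 0)"
    by (subst stage_down.simps) simp
  moreover have "stage_up HC C (Suc (Suc n)) (0, ell2_single [] d) = (k, 0)"
    by (subst stage_up.simps) (simp only: h(1) k)
  moreover have "(k, 0) \<in> stage_space HC C (Suc (Suc n))"
    using C.stage_unitary_in[OF h(2)] by (simp only: k)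
  ultimately show ?case using h(3) by auto
qed

lemma Q_proj_vacuum:
  assumes d: "d \<in> DC"
  shows "Q_proj HC C (Suc n) (0, ell2_single [] d) = (0, ell2_single [] d)"
  unfolding Q_proj_def
proof (rule orth_proj_eqI)
  let ?M = "{(l, f) \<in> dilation_space HC C. \<forall>\<alpha>. Suc n \<le> length \<alpha> \<longrightarrow> ell2_nth f \<alpha> = 0}"
  show "csubspace ?M"
    using C.csubspace_H C.csubspace_defect_space
    by (auto simp: csubspace_def dilation_space_def fock_tensor_def scaleC_prod_def zero_prod_def)
  show "(0, ell2_single [] d) \<in> ?M"
    using d csubspace_0[OF C.csubspace_H] fock_tensor_single[OF C.csubspace_defect_space]
    by (auto simp: dilation_space_def ell2_nth_single)
qed simp

text \<open>The sequence that defines \<open>W\<^sup>*\<close> is constant from its second term on.\<close>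

theorem W_star_vacuum:
  assumes d: "d \<in> DC"
  shows "W_star HC C HE E (ell2_single [] d) = (row_op E d, ell2_single [] (defect_op HE E d))"
proof -
  have "stage_down HE E n (stage_up HC C n (Q_proj HC C n (0, ell2_single [] d)))
      = (row_op E d, ell2_single [] (defect_op HE E d))" if "1 \<le> n" for n
    using that stage_down_stage_up[OF d, of "n - 1"] Q_proj_vacuum[OF d, of "n - 1"] by auto
  then have "(\<lambda>n. stage_down HE E n (stage_up HC C n (Q_proj HC C n (0, ell2_single [] d))))
      \<longlonglongrightarrow> (row_op E d, ell2_single [] (defect_op HE E d))"
    by (intro tendsto_eventually eventually_sequentiallyI[of 1])
  then show ?thesis
    unfolding W_star_def What_star_def by (rule limI)
qed

lemma closed_csubspace_L: "closed_csubspace L"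
  by (intro closed_csubspace_Times closed_csubspace_orth_minus E.closed_H
      closed_csubspace_fock_tensor E.closed_csubspace_defect_space)

lemma dilation_L: "dilation HE E j ` L \<subseteq> L"
proof (rule image_subsetI)
  fix x assume "x \<in> L"
  then obtain l f where x: "x = (l, f)" and l: "l \<in> HA" and f: "f \<in> fock_tensor DE" by auto
  have "ell2_single [] (defect_comp HE E j l) + ell2_create j f \<in> fock_tensor DE"
    using l f by (intro csubspace_add closed_csubspaceD closed_csubspace_fock_tensor
        E.closed_csubspace_defect_space fock_tensor_single fock_tensor_create
        E.csubspace_defect_space E.defect_comp_in HA_D(1))
  then show "dilation HE E j x \<in> L"
    using E_HA[OF l] by (simp add: dilation_def x)
qed

lemma row_isometry_L: "row_isometry L (dilation HE E)"
proof (rule row_isometry_subset[OF E.dilation_row_isometry _ dilation_L])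
  show "L \<subseteq> HE \<times> fock_tensor DE" by (auto simp: orth_minus_def)
qed

text \<open>As a row operator, the dilation of a coisometric tuple is a unitary from the \<open>d\<close>-fold sum of
  the dilation space onto that space, so
  the complement of the ranges \<open>V\<^sub>j L\<close> within \<open>L\<close> can be read off in coordinates \<open>l \<in> HE\<^sup>d\<close>: being
  orthogonal to the ranges forces the Fock part to live on the vacuum and \<open>l\<close> to be orthogonal to
  \<open>HA\<^sup>d\<close>, that is \<open>l \<in> HC\<^sup>d\<close>, while lying in \<open>L\<close> means that the \<open>HC\<close>-component \<open>row_op C l\<close> of
  \<open>row_op E l\<close> vanishes. Together this says \<open>l \<in> DC\<close>.\<close>

lemma wandering_part_L:
  "wandering_part L (dilation HE E) = (\<lambda>d. (row_op E d, ell2_single [] (defect_op HE E d))) ` DC"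
proof (intro equalityI subsetI)
  fix x assume "x \<in> wandering_part L (dilation HE E)"
  then have xL: "x \<in> L" and orth: "\<And>j y. y \<in> L \<Longrightarrow> cinner (dilation HE E j y) x = 0"
    by (auto simp: wandering_part_eq)
  obtain h f where x: "x = (h, f)" "h \<in> HA" "f \<in> fock_tensor DE" using xL by auto
  have fD: "ell2_nth f w \<in> DE" for w using x(3) by (simp add: fock_tensor_def)
  have HA0: "0 \<in> HA" using csubspace_0[OF E.csubspace_H] by (simp add: orth_minus_def)
  have "ell2_nth f (j # w) = 0" for j w
  proof -
    have "ell2_single w (ell2_nth f (j # w)) \<in> fock_tensor DE"
      by (rule fock_tensor_single[OF E.csubspace_defect_space fD])
    then show ?thesis
      using orth[of "(0, ell2_single w (ell2_nth f (j # w)))" j] HA0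
      by (simp add: E.dilation_zero ell2_create_single cinner_single_left cinner_prod_def x(1))
  qed
  then have f: "f = ell2_single [] (ell2_nth f [])"
    by (intro ell2_eqI) (auto simp: ell2_nth_single neq_Nil_conv)
  \<comment> \<open>the coordinates of \<open>x\<close> under the inverse of \<open>v \<mapsto> (row_op E v, defect_op HE E v)\<close>\<close>
  define d where "d = E.row_adjoint h + ell2_nth f []"
  have dE: "d \<in> direct_sum HE"
    using fD unfolding d_def by (intro csubspace_add[OF E.csubspace_sum_H] E.row_adjoint_in)
      (simp add: E.defect_space_eq)
  have row: "row_op E d = h"
    using fD[of "[]"] unfolding d_def
    by (simp add: bounded_clinear_onD(2)[OF E.row_op_bounded] E.row_adjoint_in
        E.row_op_row_adjoint HA_D(1)[OF x(2)] E.defect_space_eq)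
  then have defect: "defect_op HE E d = ell2_nth f []"
    using E.row_adjoint_plus_defect[OF dE] by (simp add: d_def)
  have "d $ j \<in> HC" for j
  proof (rule HC_I[OF direct_sum_nth[OF dE]])
    fix a assume a: "a \<in> HA"
    have "cinner a (d $ j) = cinner (E j a) h + cinner a (ell2_nth f [] $ j)"
      using E.cinner_row_op[OF E.axis_in_sum[OF HA_D(1)[OF a]], of j h]
      by (simp add: d_def cinner_add_right E.row_op_axis cinner_axis_left)
    also have "\<dots> = cinner (dilation HE E j (a, 0)) x"
      by (simp add: x(1) dilation_def cinner_prod_def cinner_single_left
          E.cinner_defect_comp[OF HA_D(1)[OF a] fD])
    also have "\<dots> = 0"
      using a csubspace_0[OF closed_csubspaceD(1)[OF closed_csubspace_fock_tensor[OF E.closed_csubspace_defect_space]]]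
      by (intro orth) simp
    finally show "cinner a (d $ j) = 0" .
  qed
  then have dC: "d \<in> direct_sum HC" by (simp add: direct_sum_def)
  have "row_op C d = 0"
  proof (rule orthogonal_self[OF C.csubspace_H C.row_op_in[OF dC] csubspace_0[OF C.csubspace_H]])
    fix z assume z: "z \<in> HC"
    show "cinner z (row_op C d - 0) = 0"
      using cinner_row_op_lift[OF z dC] HA_D(2)[OF x(2) z] by (simp add: row)
  qed
  with dC have "d \<in> DC" by (simp add: C.defect_space_eq)
  then show "x \<in> (\<lambda>d. (row_op E d, ell2_single [] (defect_op HE E d))) ` DC"
    using f by (intro image_eqI[of _ _ d]) (simp_all add: x(1) row defect)
next
  fix x :: "('a, 'd) dil"
  assume "x \<in> (\<lambda>d. (row_op E d, ell2_single [] (defect_op HE E d))) ` DC"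
  then obtain d where d: "d \<in> DC" and x: "x = (row_op E d, ell2_single [] (defect_op HE E d))" by auto
  have dC: "d \<in> direct_sum HC" "row_op C d = 0" using d by (auto simp: C.defect_space_eq)
  note dE = direct_sum_subset[OF dC(1)]
  have "row_op E d \<in> HA"
    using E.row_op_in[OF dE] cinner_row_op_lift[OF _ dC(1)] dC(2) by (simp add: orth_minus_def)
  moreover have "cinner (dilation HE E j (a, g)) x = 0" if a: "a \<in> HA" for j a g
  proof -
    note aE = E.axis_in_sum[OF HA_D(1)[OF a], of j]
    have "cinner (dilation HE E j (a, g)) x
        = cinner (row_op E (axis j a)) (row_op E d) + cinner (defect_op HE E (axis j a)) (defect_op HE E d)"
      by (simp add: x dilation_def cinner_prod_def cinner_add_left cinner_single_left[of "[]"]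
          ell2_nth_single E.row_op_axis defect_comp_def)
    also have "\<dots> = cinner a (d $ j)"
      by (simp add: E.cinner_row_op_defect[OF aE dE] cinner_axis_left)
    also have "\<dots> = 0"
      by (rule HA_D(3)[OF a direct_sum_nth[OF dC(1)]])
    finally show ?thesis .
  qed
  ultimately show "x \<in> wandering_part L (dilation HE E)"
    using fock_tensor_single[OF E.csubspace_defect_space E.defect_op_in[OF dE]]
    by (auto simp: wandering_part_eq x)
qed

lemma wandering_part_L_W_star:
  "W_star HC C HE E ` ell2_single [] ` DC = wandering_part L (dilation HE E)"
  by (simp add: wandering_part_L image_image W_star_vacuum)

text \<open>On \<open>{0} \<times> fock_tensor DE\<close> the dilation is the creation operator, whose range misses the
  vacuum component.\<close>

lemma wandering_vacuum: "wandering L (dilation HE E) ((\<lambda>d. (0, ell2_single [] d)) ` DE)" (is "wandering _ _ ?M")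
proof (rule wanderingI[OF closed_csubspaceD(1)[OF closed_csubspace_L] row_isometry_L])
  have vacuum: "ell2_single [] (ell2_nth f []) = f" if "\<And>\<alpha>. \<alpha> \<noteq> [] \<Longrightarrow> ell2_nth f \<alpha> = 0"
    for f :: "('d list, 'a ^ 'd) ell2"
    by (rule ell2_eqI) (simp add: ell2_nth_single that)
  have "?M = {0} \<times> (fock_tensor DE \<inter> (\<Inter>\<alpha>\<in>- {[]}. {f \<in> UNIV. ell2_nth f \<alpha> \<in> {0}}))" (is "_ = ?N")
  proof (intro equalityI subsetI)
    fix x assume "x \<in> ?M"
    then show "x \<in> ?N"
      using fock_tensor_single[OF E.csubspace_defect_space] by (auto simp: ell2_nth_single)
  next
    fix x assume "x \<in> ?N"
    then obtain f where f: "x = (0, f)" "f \<in> fock_tensor DE" "\<And>\<alpha>. \<alpha> \<noteq> [] \<Longrightarrow> ell2_nth f \<alpha> = 0" by auto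
    then show "x \<in> ?M"
      by (intro image_eqI[of _ _ "ell2_nth f []"]) (simp_all add: vacuum fock_tensor_def)
  qed
  moreover have "closed_csubspace {f :: ('d list, 'a ^ 'd) ell2. ell2_nth f \<alpha> = 0}" for \<alpha>
    using closed_csubspace_preimage[OF bounded_clinear_on_ell2_nth closed_csubspace_UNIV
        closed_csubspace_singleton] by simp
  then have "closed_csubspace ?N"
    by (intro closed_csubspace_Times closed_csubspace_Int closed_csubspace_singleton
        closed_csubspace_fock_tensor E.closed_csubspace_defect_space closed_csubspace_Inter) auto
  ultimately show "closed_csubspace ?M" by simp
  show sub: "?M \<subseteq> L"
    using csubspace_0[OF E.csubspace_H] fock_tensor_single[OF E.csubspace_defect_space]
    by (auto simp: orth_minus_def)
  fix j \<alpha> x y assume x: "x \<in> ?M" and y: "y \<in> ?M"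
  have "\<exists>f. word_op (dilation HE E) \<alpha> x = (0, f)"
    using x by (induction \<alpha>) (auto simp: E.dilation_zero)
  then show "cinner (dilation HE E j (word_op (dilation HE E) \<alpha> x)) y = 0"
    using y by (auto simp: E.dilation_zero cinner_prod_def)
qed

end

theorem theorem3p2:
  fixes HC HE :: "'a::complex_hilbert set"
    and C E :: "'d::finite \<Rightarrow> 'a \<Rightarrow> 'a"
  assumes "closed_csubspace HC" and "closed_csubspace HE"
    and "coisometric HC C"
    and "coisometric_lifting HC C HE E"
  shows "let V = dilation HE E;
             L = (HE \<ominus> HC) \<times> fock_tensor (defect_space HE E);
             Wand_in = W_star HC C HE E ` (ell2_single [] ` defect_space HC C);
             Wand_out = (\<lambda>d. (0, ell2_single [] d)) ` defect_space HE E;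
             Gs = word_sum V Wand_in;
             G = word_sum V Wand_out
         in outgoing_Cuntz_scattering_system V L Gs G \<and>
            wandering L V Wand_in \<and> Wand_in = wandering_part L V \<and>
            wandering L V Wand_out \<and> Wand_out = wandering_part G V"
proof -
  interpret lifting HC HE C E
    using assms by unfold_locales (auto simp: coisometric_lifting_def)
  show ?thesis
    unfolding Let_def wandering_part_L_W_star
    by (intro conjI refl wandering_vacuum closed_csubspace_L row_isometry_L
        wandering_part_word_sum[OF closed_csubspace_L row_isometry_L, symmetric]
        outgoing_Cuntz_scattering_system_wandering wandering_wandering_part)
qed

end
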